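(* Let $m\ge2$. In the fundamental group $\pi_1(X,\dot x)$ of $X=\mathbb C^m\setminus S_m$ one has $$(\rho_{m+1}\cdot\rho_m\cdot\rho_{m+1}\cdot\rho_m^{-1})\cdot\rho_m=\rho_m\cdot(\rho_{m+1}\cdot\rho_m\cdot\rho_{m+1}\cdot\rho_m^{-1}).$$ Moreover, let $X'=\mathbb C^{m-1}\setminus S_{m-1}$, embedded by $x'\mapsto(x',0)$ in $$\widetilde X=\{x\in\mathbb C^m\mid x_1\cdots x_{m-1}R_m(x)\ne0\},$$ and let $\rho_m'$ be the last generator of $\pi_1(X',\dot x')$, $\dot x'=(\varepsilon_1,\dots,\varepsilon_{m-1})$ (the analogue for $m-1$ variables of $\rho_{m+1}$). Then the loop $\rho_{m+1}\cdot\rho_m\cdot\rho_{m+1}\cdot\rho_m^{-1}$ is homotopic in $\widetilde X$ to $\rho_m'$, where the base points $\dot x$ and $(\dot x',0)$ are identified through the segment $\{(\varepsilon_1,\dots,\varepsilon_{m-1},s\varepsilon_m)\mid 0\le s\le1\}\subset\widetilde X$.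
   Context: For $n\ge1$, $R_n(x_1,\dots,x_n)=\prod_{\sigma_1,\dots,\sigma_n=\pm1}(1+\sigma_1\sqrt{x_1}+\cdots+\sigma_n\sqrt{x_n})$, a polynomial of degree $2^{n-1}$, and $S_n=\{x\in\mathbb C^n\mid x_1\cdots x_nR_n(x)=0\}$. The base point is $\dot x=(\varepsilon_1,\dots,\varepsilon_m)$ with $\varepsilon_j$ sufficiently small positive reals satisfying $\varepsilon_1\gg\cdots\gg\varepsilon_m$ (each sufficiently small relative to the preceding ones). Loops in $X$: $\rho_m:[0,1]\ni t\mapsto(\varepsilon_1,\dots,\varepsilon_{m-1},\varepsilon_me^{2\pi\sqrt{-1}t})$. The loop $\rho_{m+1}$ lies in the intersection of $X$ with the complex line $L=\{t\dot x\mid t\in\mathbb C\}$: it starts from $\dot x$ and goes along the real segment towards the point of $\{R_m=0\}\cap L$ nearest to $\dot x$ (namely $t\dot x$ with $t=(\sqrt{\varepsilon_1}+\cdots+\sqrt{\varepsilon_m})^{-2}$), turns around it once positively on a small circle in $L$, and traces back to $\dot x$. The loop $\rho_m'$ in $X'$ is defined in the same way with $m-1$, $\dot x'$, $R_{m-1}$ and $L'=\{t\dot x'\mid t\in\mathbb C\}$ in place of $m$, $\dot x$, $R_m$ and $L$. It is known (Goto) that $(\rho_i\rho_{m+1})^2=(\rho_{m+1}\rho_i)^2$ in $\pi_1(X,\dot x)$ for $1\le i\le m$. In a product $\alpha\cdot\beta$ the loop $\alpha$ is traversed first. *)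

theory Defs
  imports "HOL-Complex_Analysis.Contour_Integration" "HOL-Algebra.Group"
begin

section \<open>The fundamental group\<close>

definition path_class :: "'a::topological_space set \<Rightarrow> (real \<Rightarrow> 'a) \<Rightarrow> (real \<Rightarrow> 'a) set"
  where "path_class S p = {q. homotopic_paths S p q}"

definition loops_at :: "'a::topological_space set \<Rightarrow> 'a \<Rightarrow> (real \<Rightarrow> 'a) set"
  where "loops_at S a = {p. path p \<and> path_image p \<subseteq> S \<and> pathstart p = a \<and> pathfinish p = a}"

text \<open>In a product the first factor is traversed first, as in \<^term>\<open>p +++ q\<close>.\<close>

definition fundamental_group :: "'a::topological_space set \<Rightarrow> 'a \<Rightarrow> (real \<Rightarrow> 'a) set monoid"
  where "fundamental_group S a =
    \<lparr>carrier = path_class S ` loops_at S a,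
     monoid.mult = (\<lambda>A B. \<Union>p\<in>A. \<Union>q\<in>B. path_class S (p +++ q)),
     one = path_class S (\<lambda>_. a)\<rparr>"

lemma path_class_eq:
  assumes "homotopic_paths S p q"
  shows "path_class S p = path_class S q"
  using assms unfolding path_class_def
  by (auto intro: homotopic_paths_trans homotopic_paths_sym)

lemma path_class_eq_iff:
  assumes "path p" "path_image p \<subseteq> S"
  shows "path_class S p = path_class S q \<longleftrightarrow> homotopic_paths S p q"
proof
  assume "path_class S p = path_class S q"
  moreover have "p \<in> path_class S p"
    using assms by (simp add: path_class_def)
  ultimately show "homotopic_paths S p q"
    by (simp add: path_class_def homotopic_paths_sym)
qed (rule path_class_eq)

lemma loops_at_join: "p \<in> loops_at S a \<Longrightarrow> q \<in> loops_at S a \<Longrightarrow> p +++ q \<in> loops_at S a"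
  by (auto simp: loops_at_def path_image_join)

lemma loops_at_reverse: "p \<in> loops_at S a \<Longrightarrow> reversepath p \<in> loops_at S a"
  by (auto simp: loops_at_def)

lemma loops_at_const: "a \<in> S \<Longrightarrow> (\<lambda>_. a) \<in> loops_at S a"
  by (auto simp: loops_at_def path_def path_image_def pathstart_def pathfinish_def)

lemma path_class_mult:
  assumes "p \<in> loops_at S a" "q \<in> loops_at S a"
  shows "path_class S p \<otimes>\<^bsub>fundamental_group S a\<^esub> path_class S q = path_class S (p +++ q)"
proof -
  have *: "path_class S (p' +++ q') = path_class S (p +++ q)"
    if "p' \<in> path_class S p" "q' \<in> path_class S q" for p' q'
    using that assms
    by (intro path_class_eq [OF homotopic_paths_sym] homotopic_paths_join)
       (auto simp: path_class_def loops_at_def)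
  have "p \<in> path_class S p" "q \<in> path_class S q"
    using assms by (auto simp: path_class_def loops_at_def)
  then have "(\<Union>p'\<in>path_class S p. \<Union>q'\<in>path_class S q. path_class S (p +++ q)) = path_class S (p +++ q)"
    by blast
  moreover have "(\<Union>p'\<in>path_class S p. \<Union>q'\<in>path_class S q. path_class S (p' +++ q')) =
      (\<Union>p'\<in>path_class S p. \<Union>q'\<in>path_class S q. path_class S (p +++ q))"
    by (intro SUP_cong refl *)
  ultimately show ?thesis
    by (simp only: fundamental_group_def monoid.simps)
qed

lemma homotopic_join_const:
  fixes p :: "real \<Rightarrow> 'a::topological_space"
  assumes "path p" "path_image p \<subseteq> S"
  shows "homotopic_paths S (p +++ (\<lambda>_. pathfinish p)) p"
proof -
  have c: "continuous_on {0..1} (\<lambda>t::real. if t \<le> 1/2 then 2 *\<^sub>R t else 1)"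
    unfolding split_01
    by (rule continuous_on_cases continuous_intros | force)+
  show ?thesis
    apply (rule homotopic_paths_sym)
    using assms unfolding pathfinish_def joinpaths_def
    by (intro c homotopic_paths_reparametrize [where f = "\<lambda>t. if t \<le> 1/2 then 2 *\<^sub>R t else 1"]; force)
qed

lemma homotopic_const_join:
  fixes p :: "real \<Rightarrow> 'a::topological_space"
  assumes "path p" "path_image p \<subseteq> S"
  shows "homotopic_paths S ((\<lambda>_. pathstart p) +++ p) p"
proof -
  have c: "continuous_on {0..1} (\<lambda>t::real. if t \<le> 1/2 then 0 else 2 *\<^sub>R t - 1)"
    unfolding split_01
    by (rule continuous_on_cases continuous_intros | force)+
  show ?thesis
    apply (rule homotopic_paths_sym)
    using assms unfolding pathstart_def joinpaths_def
    by (intro c homotopic_paths_reparametrize [where f = "\<lambda>t. if t \<le> 1/2 then 0 else 2 *\<^sub>R t - 1"]; force)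
qed

lemma homotopic_join_reverse:
  fixes p :: "real \<Rightarrow> 'a::topological_space"
  assumes "path p" "path_image p \<subseteq> S"
  shows "homotopic_paths S (p +++ reversepath p) (\<lambda>_. pathstart p)"
proof -
  have p: "continuous_on {0..1} p"
    using assms by (auto simp: path_def)
  let ?A = "{0..1} \<times> {0..1::real}"
  let ?h = "\<lambda>y::real\<times>real. if snd y \<le> 1/2 then p (fst y * (2 * snd y)) else p (fst y * (1 - (2 * snd y - 1)))"
  have c: "continuous_on ?A ?h"
  proof (rule continuous_on_cases_le)
    show "continuous_on {x \<in> ?A. snd x \<le> 1/2} (\<lambda>t. p (fst t * (2 * snd t)))"
         "continuous_on {x \<in> ?A. 1/2 \<le> snd x} (\<lambda>t. p (fst t * (1 - (2 * snd t - 1))))"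
         "continuous_on ?A snd"
      by (intro continuous_on_compose2 [OF p] continuous_intros; auto simp: mult_le_one)+
  qed (auto simp: algebra_simps)
  have img: "p t \<in> S" if "0 \<le> t" "t \<le> 1" for t
    using that assms(2) by (auto simp: path_image_def)
  have "homotopic_paths S (\<lambda>_. pathstart p) (p +++ reversepath p)"
    unfolding homotopic_paths
    apply (rule exI[of _ ?h])
    using c img
    by (auto simp: mult_le_one path_defs joinpaths_def reversepath_def)
  then show ?thesis
    by (rule homotopic_paths_sym)
qed

lemma fundamental_group_group:
  assumes "a \<in> S"
  shows "group (fundamental_group S a)"
proof (rule groupI)
  note mul = path_class_mult
  have car: "carrier (fundamental_group S a) = path_class S ` loops_at S a"
    and one: "\<one>\<^bsub>fundamental_group S a\<^esub> = path_class S (\<lambda>_. a)"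
    by (simp_all add: fundamental_group_def)
  note cst = loops_at_const [OF assms]
  show "\<one>\<^bsub>fundamental_group S a\<^esub> \<in> carrier (fundamental_group S a)"
    using cst by (auto simp: car one)
  fix x assume "x \<in> carrier (fundamental_group S a)"
  then obtain p where p: "x = path_class S p" "p \<in> loops_at S a"
    by (auto simp: car)
  have "homotopic_paths S ((\<lambda>_. a) +++ p) p"
    using p(2) homotopic_const_join [of p S] by (auto simp: loops_at_def)
  then show "\<one>\<^bsub>fundamental_group S a\<^esub> \<otimes>\<^bsub>fundamental_group S a\<^esub> x = x"
    using p cst by (simp add: one mul path_class_eq [of S "(\<lambda>_. a) +++ p" p])
  have "homotopic_paths S (reversepath p +++ p) (\<lambda>_. a)"
    using p(2) homotopic_join_reverse [of "reversepath p" S] by (auto simp: loops_at_def)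
  then show "\<exists>y\<in>carrier (fundamental_group S a).
      y \<otimes>\<^bsub>fundamental_group S a\<^esub> x = \<one>\<^bsub>fundamental_group S a\<^esub>"
    using p loops_at_reverse [OF p(2)]
    by (intro bexI [of _ "path_class S (reversepath p)"]) (auto simp: car one mul path_class_eq [of S "reversepath p +++ p" "\<lambda>_. a"])
  fix y assume "y \<in> carrier (fundamental_group S a)"
  then obtain q where q: "y = path_class S q" "q \<in> loops_at S a"
    by (auto simp: car)
  show "x \<otimes>\<^bsub>fundamental_group S a\<^esub> y \<in> carrier (fundamental_group S a)"
    using p q by (auto simp: car mul loops_at_join)
  fix z assume "z \<in> carrier (fundamental_group S a)"
  then obtain r where r: "z = path_class S r" "r \<in> loops_at S a"
    by (auto simp: car)
  have "homotopic_paths S (p +++ (q +++ r)) ((p +++ q) +++ r)"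
    using p q r by (intro homotopic_paths_assoc) (auto simp: loops_at_def)
  then show "x \<otimes>\<^bsub>fundamental_group S a\<^esub> y \<otimes>\<^bsub>fundamental_group S a\<^esub> z =
      x \<otimes>\<^bsub>fundamental_group S a\<^esub> (y \<otimes>\<^bsub>fundamental_group S a\<^esub> z)"
    using p q r by (simp add: mul loops_at_join path_class_eq [of S "p +++ (q +++ r)" "(p +++ q) +++ r"])
qed

lemma path_class_inv:
  assumes "p \<in> loops_at S a"
  shows "inv\<^bsub>fundamental_group S a\<^esub> path_class S p = path_class S (reversepath p)"
proof -
  have "a \<in> S"
    using assms pathstart_in_path_image [of p] by (auto simp: loops_at_def)
  then interpret group "fundamental_group S a"
    by (rule fundamental_group_group)
  note rev = loops_at_reverse [OF assms]
  have "homotopic_paths S (reversepath p +++ p) (\<lambda>_. a)"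
    using assms homotopic_join_reverse [of "reversepath p" S] by (auto simp: loops_at_def)
  then have "path_class S (reversepath p) \<otimes>\<^bsub>fundamental_group S a\<^esub> path_class S p
      = \<one>\<^bsub>fundamental_group S a\<^esub>"
    using path_class_mult [OF rev assms] by (simp add: path_class_eq [of S "reversepath p +++ p" "\<lambda>_. a"] fundamental_group_def)
  then show ?thesis
    using assms rev by (intro inv_equality) (auto simp: fundamental_group_def)
qed


section \<open>The hypersurfaces and their complements\<close>

text \<open>The space $\mathbb C^n$ is realised inside the product space \<^typ>\<open>nat \<Rightarrow> complex\<close>, the coordinates
  being indexed by $1,\dots,n$ and all other coordinates being zero. The subspace topology is the usual
  one, and the embedding $x' \mapsto (x',0)$ of $\mathbb C^{n-1}$ into $\mathbb C^n$ is \<open>append_zero n\<close>.\<close>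

definition cspace :: "nat \<Rightarrow> (nat \<Rightarrow> complex) set"
  where "cspace n = {x. \<forall>i. i \<notin> {1..n} \<longrightarrow> x i = 0}"

definition append_zero :: "nat \<Rightarrow> (nat \<Rightarrow> complex) \<Rightarrow> (nat \<Rightarrow> complex)"
  where "append_zero n x = x(n := 0)"

text \<open>All choices of signs occur, so the branch of the square root is irrelevant
  (lemma \<open>Rpoly_any_roots\<close>).\<close>

definition Rpoly :: "nat \<Rightarrow> (nat \<Rightarrow> complex) \<Rightarrow> complex"
  where "Rpoly n x = (\<Prod>\<sigma>\<in>{1..n} \<rightarrow>\<^sub>E {1, -1}. 1 + (\<Sum>j\<in>{1..n}. \<sigma> j * csqrt (x j)))"

definition Sset :: "nat \<Rightarrow> (nat \<Rightarrow> complex) set"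
  where "Sset n = {x \<in> cspace n. (\<Prod>j\<in>{1..n}. x j) * Rpoly n x = 0}"

definition Xspace :: "nat \<Rightarrow> (nat \<Rightarrow> complex) set"
  where "Xspace n = cspace n - Sset n"

definition Xtilde :: "nat \<Rightarrow> (nat \<Rightarrow> complex) set"
  where "Xtilde m = {x \<in> cspace m. (\<Prod>j\<in>{1..m-1}. x j) * Rpoly m x \<noteq> 0}"

lemma Rpoly_any_roots:
  assumes "\<forall>j\<in>{1..n}. (w j)\<^sup>2 = x j"
  shows "Rpoly n x = (\<Prod>\<sigma>\<in>{1..n} \<rightarrow>\<^sub>E {1, -1}. 1 + (\<Sum>j\<in>{1..n}. \<sigma> j * w j))"
proof -
  define e :: "nat \<Rightarrow> complex" where "e j = (if csqrt (x j) = w j then 1 else -1)" for j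
  have e: "e j * w j = csqrt (x j)" if "j \<in> {1..n}" for j
  proof -
    have "(csqrt (x j))\<^sup>2 = (w j)\<^sup>2"
      using assms that by simp
    then show ?thesis
      unfolding e_def power2_eq_iff by auto
  qed
  let ?P = "{1..n} \<rightarrow>\<^sub>E {1, -1::complex}"
  let ?f = "\<lambda>\<sigma>. \<lambda>j\<in>{1..n}. \<sigma> j * e j"
  have ee: "e j * e j = 1" for j
    by (simp add: e_def)
  have e1: "e j \<in> {1, -1}" for j
    by (simp add: e_def)
  have f1: "?f \<sigma> \<in> ?P" if "\<sigma> \<in> ?P" for \<sigma>
  proof (rule restrict_PiE_iff [THEN iffD2], rule ballI)
    fix j assume "j \<in> {1..n}"
    then have "\<sigma> j \<in> {1, -1}"
      using that by (rule PiE_mem [rotated])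
    then show "\<sigma> j * e j \<in> {1, -1}"
      using e1 [of j] by auto
  qed
  have f2: "?f (?f \<sigma>) = \<sigma>" if "\<sigma> \<in> ?P" for \<sigma>
  proof
    fix j show "?f (?f \<sigma>) j = \<sigma> j"
      using PiE_arb [OF that, of j] ee [of j] by (cases "j \<in> {1..n}") (simp_all add: mult.assoc)
  qed
  have "bij_betw ?f ?P ?P"
    by (rule bij_betw_byWitness [where f' = ?f]) (intro ballI f2 image_subsetI f1; assumption)+
  then have "(\<Prod>\<sigma>\<in>?P. 1 + (\<Sum>j\<in>{1..n}. \<sigma> j * w j)) = (\<Prod>\<sigma>\<in>?P. 1 + (\<Sum>j\<in>{1..n}. ?f \<sigma> j * w j))"
    by (rule prod.reindex_bij_betw [symmetric])
  also have "\<dots> = Rpoly n x"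
    unfolding Rpoly_def
    by (intro prod.cong refl arg_cong2 [where f = "(+)"] sum.cong) (auto simp: e mult.assoc)
  finally show ?thesis ..
qed

lemma Rpoly_eq_0_iff:
  assumes "\<forall>j\<in>{1..n}. (w j)\<^sup>2 = x j"
  shows "Rpoly n x = 0 \<longleftrightarrow> (\<exists>\<sigma>\<in>{1..n} \<rightarrow>\<^sub>E {1, -1}. 1 + (\<Sum>j\<in>{1..n}. \<sigma> j * w j) = 0)"
  by (subst Rpoly_any_roots [OF assms]) (auto simp: finite_PiE)

lemma append_zero_Xspace:
  assumes "m \<ge> 2" "x \<in> Xspace (m - 1)"
  shows "append_zero m x \<in> Xtilde m"
proof -
  have x: "x \<in> cspace (m - 1)" "(\<Prod>j\<in>{1..m-1}. x j) \<noteq> 0" "Rpoly (m-1) x \<noteq> 0"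
    using assms(2) by (auto simp: Xspace_def Sset_def)
  have xm: "append_zero m x = x"
    using x(1) assms(1) by (force simp: append_zero_def cspace_def)
  have m0: "x m = 0"
    using x(1) assms(1) by (force simp: cspace_def)
  have I: "{1..m} = insert m {1..m-1}"
    using assms(1) by auto
  have "Rpoly m x \<noteq> 0"
  proof
    assume "Rpoly m x = 0"
    then obtain \<sigma> where s: "\<sigma> \<in> {1..m} \<rightarrow>\<^sub>E {1, -1}" "1 + (\<Sum>j\<in>{1..m}. \<sigma> j * csqrt (x j)) = 0"
      using Rpoly_eq_0_iff [of m "\<lambda>j. csqrt (x j)" x] by auto
    have "restrict \<sigma> {1..m-1} \<in> {1..m-1} \<rightarrow>\<^sub>E {1, -1}"
      by (rule restrict_PiE_iff [THEN iffD2], rule ballI, rule PiE_mem [OF s(1)]) (use I in blast)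
    moreover have "1 + (\<Sum>j\<in>{1..m-1}. restrict \<sigma> {1..m-1} j * csqrt (x j)) = 0"
      using s(2) assms(1) m0 unfolding I by (subst (asm) sum.insert) auto
    ultimately have "\<exists>\<sigma>\<in>{1..m-1} \<rightarrow>\<^sub>E {1, -1}. 1 + (\<Sum>j\<in>{1..m-1}. \<sigma> j * csqrt (x j)) = 0"
      by - (rule bexI [where x = "restrict \<sigma> {1..m-1}"])
    then have "Rpoly (m-1) x = 0"
      using Rpoly_eq_0_iff [of "m-1" "\<lambda>j. csqrt (x j)" x] by simp
    with x(3) show False by simp
  qed
  with x xm show ?thesis
    by (auto simp: Xtilde_def cspace_def)
qed


section \<open>The base points and the loops\<close>

definition basept :: "nat \<Rightarrow> (nat \<Rightarrow> real) \<Rightarrow> (nat \<Rightarrow> complex)"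
  where "basept n \<epsilon> = (\<lambda>j. if j \<in> {1..n} then of_real (\<epsilon> j) else 0)"

text \<open>The condition $1 \gg \varepsilon_1 \gg \cdots \gg \varepsilon_m > 0$: the function \<open>\<delta>\<close> gives, for the list
  $[\varepsilon_1,\dots,\varepsilon_{j-1}]$, the bound that $\varepsilon_j$ has to satisfy. The phrase ``for sufficiently small
  $\varepsilon_1 \gg \cdots \gg \varepsilon_m$'' means that a suitable positive \<open>\<delta>\<close> exists, i.e. it stands for
  the nested quantifiers $\exists\delta_1\,\forall\varepsilon_1<\delta_1\,\exists\delta_2\,\forall\varepsilon_2<\delta_2\cdots$.\<close>

definition successively_small :: "(real list \<Rightarrow> real) \<Rightarrow> nat \<Rightarrow> (nat \<Rightarrow> real) \<Rightarrow> bool"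
  where "successively_small \<delta> m \<epsilon> \<longleftrightarrow> (\<forall>j\<in>{1..m}. 0 < \<epsilon> j \<and> \<epsilon> j < \<delta> (map \<epsilon> [1..<j]))"

definition line_point :: "nat \<Rightarrow> (nat \<Rightarrow> real) \<Rightarrow> complex \<Rightarrow> (nat \<Rightarrow> complex)"
  where "line_point n \<epsilon> t = (\<lambda>j. t * basept n \<epsilon> j)"

text \<open>The parameter on the line $L = \{t\dot x\}$ of the nearest point of $\{R_n = 0\} \cap L$
  (see lemma \<open>nearest_param_nearest\<close>).\<close>

definition nearest_param :: "nat \<Rightarrow> (nat \<Rightarrow> real) \<Rightarrow> real"
  where "nearest_param n \<epsilon> = 1 / (\<Sum>j\<in>{1..n}. sqrt (\<epsilon> j))\<^sup>2"

text \<open>The circle of radius \<open>r\<close> around the nearest point is small if the base point ($t = 1$) lies outside of it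
  and the closed disc bounded by it meets the complement of $X$ only in its centre.\<close>

definition small_radius :: "nat \<Rightarrow> (nat \<Rightarrow> real) \<Rightarrow> real \<Rightarrow> bool"
  where "small_radius n \<epsilon> r \<longleftrightarrow>
    0 < r \<and> r < nearest_param n \<epsilon> - 1 \<and>
    (\<forall>t\<in>cball (of_real (nearest_param n \<epsilon>)) r - {of_real (nearest_param n \<epsilon>)}.
        line_point n \<epsilon> t \<in> Xspace n)"

definition lasso :: "real \<Rightarrow> real \<Rightarrow> real \<Rightarrow> complex"
  where "lasso c r =
    linepath 1 (of_real (c - r)) +++
    part_circlepath (of_real c) r pi (3 * pi) +++
    linepath (of_real (c - r)) 1"

text \<open>\<open>rho m\<close> is the loop $\rho_m$; \<open>rho_last n\<close> is the last generator for \<open>n\<close> variables, i.e. $\rho_{m+1}$ for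
  $n = m$ and $\rho'_m$ for $n = m - 1$.\<close>

definition rho :: "nat \<Rightarrow> (nat \<Rightarrow> real) \<Rightarrow> real \<Rightarrow> (nat \<Rightarrow> complex)"
  where "rho m \<epsilon> = (\<lambda>t. (basept m \<epsilon>)(m := of_real (\<epsilon> m) * exp (2 * of_real pi * \<i> * of_real t)))"

definition rho_last :: "nat \<Rightarrow> (nat \<Rightarrow> real) \<Rightarrow> real \<Rightarrow> real \<Rightarrow> (nat \<Rightarrow> complex)"
  where "rho_last n \<epsilon> r = line_point n \<epsilon> \<circ> lasso (nearest_param n \<epsilon>) r"

text \<open>The segment from $\dot x$ to $(\dot x', 0)$.\<close>

definition base_segment :: "nat \<Rightarrow> (nat \<Rightarrow> real) \<Rightarrow> real \<Rightarrow> (nat \<Rightarrow> complex)"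
  where "base_segment m \<epsilon> = (\<lambda>s. (basept m \<epsilon>)(m := of_real ((1 - s) * \<epsilon> m)))"

lemma Rpoly_line_point:
  assumes "\<forall>j\<in>{1..n}. 0 < \<epsilon> j"
  shows "Rpoly n (line_point n \<epsilon> t) = 0 \<longleftrightarrow>
    (\<exists>\<sigma>\<in>{1..n} \<rightarrow>\<^sub>E {1, -1}. t * of_real ((\<Sum>j\<in>{1..n}. \<sigma> j * sqrt (\<epsilon> j))\<^sup>2) = 1)"
    (is "?L \<longleftrightarrow> ?R")
proof -
  let ?w = "\<lambda>j. csqrt t * of_real (sqrt (\<epsilon> j))"
  have w: "\<forall>j\<in>{1..n}. (?w j)\<^sup>2 = line_point n \<epsilon> t j"
    using assms
    by (simp add: line_point_def basept_def power_mult_distrib less_imp_le flip: of_real_power)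
  have emb: "(\<Sum>j\<in>{1..n}. of_real (\<sigma> j) * ?w j) = csqrt t * of_real (\<Sum>j\<in>{1..n}. \<sigma> j * sqrt (\<epsilon> j))"
    for \<sigma> :: "nat \<Rightarrow> real"
    by (simp add: sum_distrib_left algebra_simps)
  show ?thesis
  proof
    assume ?L
    then obtain \<sigma> where s: "\<sigma> \<in> {1..n} \<rightarrow>\<^sub>E {1, -1}" "1 + (\<Sum>j\<in>{1..n}. \<sigma> j * ?w j) = 0"
      using Rpoly_eq_0_iff [OF w] by auto
    let ?s = "\<lambda>j\<in>{1..n}. Re (\<sigma> j)"
    have s': "of_real (?s j) = \<sigma> j" if "j \<in> {1..n}" for j
      using PiE_mem [OF s(1) that] that by auto
    have "1 + (\<Sum>j\<in>{1..n}. of_real (?s j) * ?w j) = 0"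
      using s(2) by (simp only: s' cong: sum.cong)
    then have "csqrt t * of_real (\<Sum>j\<in>{1..n}. ?s j * sqrt (\<epsilon> j)) = -1"
      unfolding emb by (simp add: eq_neg_iff_add_eq_0 add.commute)
    then have "(csqrt t)\<^sup>2 * (of_real (\<Sum>j\<in>{1..n}. ?s j * sqrt (\<epsilon> j)))\<^sup>2 = 1"
      by (metis power_mult_distrib power2_minus one_power2)
    then have "t * of_real ((\<Sum>j\<in>{1..n}. ?s j * sqrt (\<epsilon> j))\<^sup>2) = 1"
      by (simp only: power2_csqrt of_real_power)
    moreover have "?s \<in> {1..n} \<rightarrow>\<^sub>E {1, -1}"
    proof (rule restrict_PiE_iff [THEN iffD2], rule ballI)
      fix j assume "j \<in> {1..n}"
      from PiE_mem [OF s(1) this] show "Re (\<sigma> j) \<in> {1, -1}"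
        by auto
    qed
    ultimately show ?R
      by (rule bexI [where x = ?s])
  next
    assume ?R
    then obtain \<sigma> :: "nat \<Rightarrow> real" where s: "\<sigma> \<in> {1..n} \<rightarrow>\<^sub>E {1, -1}"
      "t * of_real ((\<Sum>j\<in>{1..n}. \<sigma> j * sqrt (\<epsilon> j))\<^sup>2) = 1" by auto
    let ?u = "csqrt t * of_real (\<Sum>j\<in>{1..n}. \<sigma> j * sqrt (\<epsilon> j))"
    have "?u\<^sup>2 = 1"
      using s(2) by (simp add: power_mult_distrib)
    then have "?u = 1 \<or> ?u = -1"
      by (simp only: power2_eq_1_iff)
    then have "of_real (-1) * ?u = -1 \<or> of_real 1 * ?u = -1"
      by (simp only: of_real_minus of_real_1 mult_minus_left mult_1_left) (metis (no_types))
    then obtain d :: real where d: "d \<in> {1, -1}" "of_real d * ?u = -1"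
      by blast
    let ?s = "\<lambda>j\<in>{1..n}. complex_of_real (d * \<sigma> j)"
    have "(\<Sum>j\<in>{1..n}. ?s j * ?w j) = (\<Sum>j\<in>{1..n}. of_real ((\<lambda>j. d * \<sigma> j) j) * ?w j)"
      by (intro sum.cong) auto
    also have "\<dots> = of_real d * ?u"
      unfolding emb by (simp add: sum_distrib_left mult.assoc mult.left_commute)
    finally have "1 + (\<Sum>j\<in>{1..n}. ?s j * ?w j) = 0"
      using d(2) by simp
    moreover have "?s \<in> {1..n} \<rightarrow>\<^sub>E {1, -1}"
      using s(1) d(1) by (auto simp: PiE_iff)
    ultimately show ?L
      using Rpoly_eq_0_iff [OF w] by blast
  qed
qed

lemma nearest_param_nearest:
  assumes "n \<ge> 1" "\<forall>j\<in>{1..n}. 0 < \<epsilon> j" "(\<Sum>j\<in>{1..n}. sqrt (\<epsilon> j)) < 1"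
  shows "Rpoly n (line_point n \<epsilon> (of_real (nearest_param n \<epsilon>))) = 0"
    and "Rpoly n (line_point n \<epsilon> t) = 0 \<Longrightarrow> dist 1 (complex_of_real (nearest_param n \<epsilon>)) \<le> dist 1 t"
proof -
  let ?S = "\<Sum>j\<in>{1..n}. sqrt (\<epsilon> j)"
  have S: "?S > 0"
    using assms(1,2) by (intro sum_pos) auto
  have "(\<Sum>j\<in>{1..n}. (\<lambda>j\<in>{1..n}. 1) j * sqrt (\<epsilon> j)) = ?S"
    by (intro sum.cong) auto
  then show "Rpoly n (line_point n \<epsilon> (of_real (nearest_param n \<epsilon>))) = 0"
    using S unfolding Rpoly_line_point [OF assms(2)]
    by (intro bexI [of _ "\<lambda>j\<in>{1..n}. 1"]) (auto simp: nearest_param_def simp flip: of_real_mult of_real_power)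
  assume "Rpoly n (line_point n \<epsilon> t) = 0"
  then obtain \<sigma> :: "nat \<Rightarrow> real" where s: "\<sigma> \<in> {1..n} \<rightarrow>\<^sub>E {1, -1}"
      "t * of_real ((\<Sum>j\<in>{1..n}. \<sigma> j * sqrt (\<epsilon> j))\<^sup>2) = 1"
    unfolding Rpoly_line_point [OF assms(2)] by auto
  define s where "s = (\<Sum>j\<in>{1..n}. \<sigma> j * sqrt (\<epsilon> j))"
  have "\<bar>s\<bar> \<le> (\<Sum>j\<in>{1..n}. \<bar>\<sigma> j * sqrt (\<epsilon> j)\<bar>)"
    unfolding s_def by (rule sum_abs)
  also have "\<dots> = ?S"
    proof (intro sum.cong refl)
    fix j assume j: "j \<in> {1..n}"
    then have "\<bar>\<sigma> j\<bar> = 1" "0 < \<epsilon> j"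
      using PiE_mem [OF s(1) j] assms(2) by auto
    then show "\<bar>\<sigma> j * sqrt (\<epsilon> j)\<bar> = sqrt (\<epsilon> j)"
      by (simp add: abs_mult)
  qed
  finally have le: "s\<^sup>2 \<le> ?S\<^sup>2"
    using S by (metis abs_le_square_iff abs_of_pos)
  have s0: "s \<noteq> 0"
    using s(2) unfolding s_def [symmetric] by auto
  have t: "t = of_real (1 / s\<^sup>2)"
    using s(2) s0 unfolding s_def [symmetric] by (simp add: field_simps)
  have "nearest_param n \<epsilon> \<le> 1 / s\<^sup>2"
    using le s0 S unfolding nearest_param_def by (intro divide_left_mono) (simp_all del: power_mono_iff)
  moreover have "1 \<le> nearest_param n \<epsilon>"
    using S assms(3) unfolding nearest_param_def by (simp add: power_le_one)
  moreover have d: "dist 1 (complex_of_real u) = \<bar>1 - u\<bar>" for u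
    by (metis dist_norm norm_of_real of_real_1 of_real_diff)
  ultimately show "dist 1 (complex_of_real (nearest_param n \<epsilon>)) \<le> dist 1 t"
    unfolding t d by linarith
qed

lemma small_radius_exists:
  assumes "n \<ge> 1" "\<forall>j\<in>{1..n}. 0 < \<epsilon> j" "(\<Sum>j\<in>{1..n}. sqrt (\<epsilon> j)) < 1"
  shows "\<exists>r. small_radius n \<epsilon> r"
proof -
  let ?S = "\<Sum>j\<in>{1..n}. sqrt (\<epsilon> j)" and ?c = "nearest_param n \<epsilon>"
  have S: "?S > 0"
    using assms(1,2) by (intro sum_pos) auto
  have c: "?c > 1"
    using S assms(3) unfolding nearest_param_def by (simp add: power_less_one_iff)
  define Z where "Z = insert 0 ((\<lambda>\<sigma>. 1 / complex_of_real ((\<Sum>j\<in>{1..n}. \<sigma> j * sqrt (\<epsilon> j))\<^sup>2)) `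
                        ({1..n} \<rightarrow>\<^sub>E {1, -1}))"
  have "finite Z"
    by (auto simp: Z_def finite_PiE)
  have Z: "line_point n \<epsilon> t \<in> Xspace n" if "t \<notin> Z" for t
  proof -
    have R: "Rpoly n (line_point n \<epsilon> t) \<noteq> 0"
    proof
      assume "Rpoly n (line_point n \<epsilon> t) = 0"
      then obtain \<sigma> :: "nat \<Rightarrow> real" where s: "\<sigma> \<in> {1..n} \<rightarrow>\<^sub>E {1, -1}"
          "t * of_real ((\<Sum>j\<in>{1..n}. \<sigma> j * sqrt (\<epsilon> j))\<^sup>2) = 1"
        unfolding Rpoly_line_point [OF assms(2)] by blast
      have "t = 1 / of_real ((\<Sum>j\<in>{1..n}. \<sigma> j * sqrt (\<epsilon> j))\<^sup>2)"
        using s(2) by (metis eq_divide_imp mult_zero_right zero_neq_one)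
      with s(1) that show False
        unfolding Z_def by blast
    qed
    have "t \<noteq> 0"
      using that by (auto simp: Z_def)
    then have "(\<Prod>j\<in>{1..n}. line_point n \<epsilon> t j) \<noteq> 0"
      using assms(2) by (auto simp: line_point_def basept_def)
    with R show ?thesis
      by (simp add: Xspace_def Sset_def cspace_def line_point_def basept_def)
  qed
  obtain d where d: "d > 0" "\<forall>x\<in>Z. x \<noteq> of_real ?c \<longrightarrow> d \<le> dist (of_real ?c) x"
    using finite_set_avoid [OF \<open>finite Z\<close>] by blast
  define r where "r = min d (?c - 1) / 2"
  have r: "0 < r" "r < d" "r < ?c - 1"
    using d(1) c by (auto simp: r_def)
  have "small_radius n \<epsilon> r"
    unfolding small_radius_def
  proof (intro conjI r ballI)
    fix t assume "t \<in> cball (of_real ?c) r - {complex_of_real ?c}"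
    then have "t \<notin> Z"
      using d(2) r(2) by (auto simp: mem_cball)
    then show "line_point n \<epsilon> t \<in> Xspace n"
      by (rule Z)
  qed
  then show ?thesis ..
qed

end

theory Submission
  imports Defs "HOL-Complex_Analysis.Complex_Analysis"
begin

text \<open>Write \<open>s = \<surd>\<epsilon>\<^sub>1 + \<dots> + \<surd>\<epsilon>\<^bsub>m-1\<^esub>\<close> and \<open>e = \<surd>\<epsilon>\<^sub>m\<close>. All loops live in the surface of points
  \<open>(w\<^sup>2 \<epsilon>\<^sub>1, \<dots>, w\<^sup>2 \<epsilon>\<^bsub>m-1\<^esub>, z)\<close>. In the coordinate \<open>y = s w - 1\<close> the hypersurface \<open>R\<^sub>m = 0\<close> is near the
  relevant points the parabola \<open>y\<^sup>2 = z\<close>, which is tangent to \<open>z = 0\<close> at the origin. The last generator is a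
  loop in the line \<open>z = e\<^sup>2\<close> around \<open>y = - e\<close>, and \<open>\<rho>\<^sub>m\<close> turns \<open>z\<close> around \<open>0\<close>. Following the half turn
  \<open>(y, z) \<mapsto> (c y, c\<^sup>2 z)\<close>, conjugation by \<open>\<rho>\<^sub>m\<close> takes the former to a loop around \<open>y = e\<close>, and the product
  of the two is the circle \<open>\<bar>y\<bar> = 2 e\<close> around both points. This circle commutes with \<open>\<rho>\<^sub>m\<close>, because
  the torus \<open>\<bar>y\<bar> = 2 e\<close>, \<open>\<bar>z\<bar> = e\<^sup>2\<close> misses the hypersurface, and it can be pushed to \<open>z = 0\<close>,
  where it is the last generator for \<open>m - 1\<close> variables.\<close>

section \<open>Homotopies of paths\<close>

text \<open>One conjugation suffices because a single turn of \<open>z\<close> around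
  \<open>0\<close> exchanges the two roots of \<open>y^2 = z\<close>, so the loop around
  \<open>- e\<close> reappears around \<open>e\<close>. The half turn itself is not a loop: it
  carries \<open>y = - 2 e\<close> to \<open>y = 2 e\<close>. Its trace, the arcs and the diameter
  have different end points, so words in them make sense only in a groupoid; the holonomy maps this
  groupoid to a group, where one word computation remains. A second obstacle is that the last
  generator is given in a line through the origin, on which \<open>z\<close> varies, and with an
  arbitrary admissible radius. It has to be moved into the fibre \<open>z = e^2\<close> before the
  half turn applies. Lassos in a plane are compared by winding numbers alone, so each comparison
  takes place in a convex region with exactly one puncture. The radius \<open>2 e\<close> exceeds
  the modulus \<open>e\<close> of both punctures and is still small enough for the other factors of
  \<open>R_m\<close> to stay nonzero.\<close>

lemma homotopic_paths_convex_image: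
  fixes f :: "'a::real_normed_vector \<Rightarrow> 'b::topological_space"
  assumes "convex D" "continuous_on D f" "f \<in> D \<rightarrow> S"
    and "path p" "path_image p \<subseteq> D" "path q" "path_image q \<subseteq> D"
    and "pathstart p = pathstart q" "pathfinish p = pathfinish q"
  shows "homotopic_paths S (f \<circ> p) (f \<circ> q)"
proof -
  have "homotopic_paths D p q"
    using convex_imp_simply_connected [OF assms(1)] assms(4-9)
    unfolding simply_connected_eq_homotopic_paths by auto
  then show ?thesis
    using assms(2,3) by (rule homotopic_paths_continuous_image)
qed

text \<open>The two sides are the two boundary routes of the square from \<open>(0, 0)\<close> to
  \<open>(1, 1)\<close>. In this form a homotopy of loops with moving base point becomes a relation
  between paths.\<close>

lemma homotopic_paths_square:
  fixes H :: "real \<times> real \<Rightarrow> 'b::topological_space"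
  assumes "continuous_on ({0..1} \<times> {0..1}) H" "H \<in> {0..1} \<times> {0..1} \<rightarrow> S"
  shows "homotopic_paths S ((\<lambda>s. H (s, 0)) +++ (\<lambda>t. H (1, t))) ((\<lambda>t. H (0, t)) +++ (\<lambda>s. H (s, 1)))"
proof -
  let ?p = "(\<lambda>s::real. (s, 0::real)) +++ (\<lambda>t. (1, t))"
  let ?q = "(\<lambda>t::real. (0::real, t)) +++ (\<lambda>s. (s, 1))"
  have *: "path (\<lambda>s::real. (s, c::real))" "path (\<lambda>s::real. (c, s))" for c
    unfolding path_def by (intro continuous_intros)+
  have **: "path_image (\<lambda>s::real. (s, c::real)) = {0..1} \<times> {c}" "path_image (\<lambda>s::real. (c, s)) = {c} \<times> {0..1}" for c
    by (auto simp: path_image_def)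
  have ends: "pathstart (\<lambda>s::real. (s, c::real)) = (0, c)" "pathfinish (\<lambda>s::real. (s, c::real)) = (1, c)"
    "pathstart (\<lambda>s::real. (c, s)) = (c, 0)" "pathfinish (\<lambda>s::real. (c, s)) = (c, 1)" for c
    by (auto simp: pathstart_def pathfinish_def)
  have "homotopic_paths S (H \<circ> ?p) (H \<circ> ?q)"
    by (rule homotopic_paths_convex_image [OF _ assms])
       (auto intro!: convex_Times path_join_imp * simp: path_image_join ** ends)
  then show ?thesis
    unfolding path_compose_join unfolding comp_def .
qed

lemma homotopic_paths_fixed_ends:
  fixes H :: "real \<times> real \<Rightarrow> 'b::topological_space"
  assumes "continuous_on ({0..1} \<times> {0..1}) H" "H \<in> {0..1} \<times> {0..1} \<rightarrow> S"
    and "\<And>s. s \<in> {0..1} \<Longrightarrow> H (s, 0) = a" "\<And>s. s \<in> {0..1} \<Longrightarrow> H (s, 1) = b"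
  shows "homotopic_paths S (\<lambda>t. H (0, t)) (\<lambda>t. H (1, t))"
  unfolding homotopic_paths
  using assms by (intro exI [of _ H]) (auto simp: pathstart_def pathfinish_def)

text \<open>A closed convex neighbourhood of \<open>c\<close> is a retract of the plane by the nearest point projection,
  which moves no point to \<open>c\<close>.\<close>

lemma homotopic_paths_punctured_convex:
  fixes A :: "complex set"
  assumes A: "convex A" "closed A" "c \<in> interior A"
    and p: "path p" "path_image p \<subseteq> A - {c}" and q: "path q" "path_image q \<subseteq> A - {c}"
    and ends: "pathstart q = pathstart p" "pathfinish q = pathfinish p"
    and wn: "winding_number p c = winding_number q c"
  shows "homotopic_paths (A - {c}) p q"
proof -
  have cA: "c \<in> A" and ne: "A \<noteq> {}"
    using A(3) interior_subset by auto
  let ?r = "closest_point A"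
  have r: "?r x \<in> A - {c}" if "x \<noteq> c" for x
  proof (cases "x \<in> A")
    case True
    then show ?thesis
      using that by (simp add: closest_point_self)
  next
    case False
    \<comment> \<open>The projection of an outside point lies on the boundary of \<open>A\<close>,
      whereas \<open>c\<close> is an interior point.\<close>
    have "rel_interior A = interior A"
      using A(3) by (intro rel_interior_nonempty_interior) auto
    then have "?r x \<notin> interior A"
      using False closest_point_in_rel_interior [OF A(2) ne, of x] interior_subset
      by (metis affine_hull_nonempty_interior empty_iff A(3) UNIV_I subsetD)
    then show ?thesis
      using A(2,3) ne by (auto simp: closest_point_in_set)
  qed
  have "homotopic_paths (-{c}) p q"
    using winding_number_homotopic_paths_eq [of p c q] assms by blast
  then have "homotopic_paths (A - {c}) (?r \<circ> p) (?r \<circ> q)"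
    by (rule homotopic_paths_continuous_image)
       (use r A ne in \<open>auto intro!: continuous_on_closest_point\<close>)
  moreover have "homotopic_paths (A - {c}) p (?r \<circ> p)" "homotopic_paths (A - {c}) q (?r \<circ> q)"
    using p q by (auto intro!: homotopic_paths_eq simp: closest_point_self path_image_def image_subset_iff)
  ultimately show ?thesis
    by (meson homotopic_paths_sym homotopic_paths_trans)
qed

text \<open>In the right half plane the principal logarithm of \<open>g\<close> is continuous, and
  it returns to its initial value because \<open>g\<close> is closed; so \<open>g\<close> adds
  nothing to the increment of a logarithm of \<open>p\<close>.\<close>

lemma winding_number_mult_halfplane:
  assumes p: "path p" "0 \<notin> path_image p" and g: "path g" "\<And>t. t \<in> {0..1} \<Longrightarrow> Re (g t) > 0" "pathfinish g = pathstart g"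
  shows "winding_number (\<lambda>t. p t * g t) 0 = winding_number p 0"
proof -
  obtain q where q: "path q" "pathfinish q - pathstart q = 2 * of_real pi * \<i> * winding_number p 0"
      "\<And>t. t \<in> {0..1} \<Longrightarrow> p t = 0 + exp (q t)"
    using winding_number_as_continuous_log [OF p] by metis
  have g0: "g t \<notin> \<real>\<^sub>\<le>\<^sub>0" "g t \<noteq> 0" if "t \<in> {0..1}" for t
    using g(2) [OF that] by (auto simp: complex_nonpos_Reals_iff)
  define l where "l = (\<lambda>t. q t + Ln (g t))"
  have "path l"
    using q(1) g(1) g0 unfolding l_def path_def by (intro continuous_intros) auto
  have "winding_number (\<lambda>t. p t * g t) 0 = winding_number (exp \<circ> l) 0"
  proof (rule winding_number_cong)
    show "p t * g t = (exp \<circ> l) t" if "0 \<le> t" "t \<le> 1" for t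
      using q(3) g0 that by (simp add: l_def exp_add)
  qed
  also have "\<dots> = (pathfinish l - pathstart l) / (2 * of_real pi * \<i>)"
    by (rule winding_number_compose_exp) fact
  also have "pathfinish l - pathstart l = pathfinish q - pathstart q"
    using g(3) by (simp add: l_def pathfinish_def pathstart_def)
  finally show ?thesis
    using q(2) by simp
qed

section \<open>The fundamental groupoid\<close>

text \<open>Along chosen connecting paths from \<open>a\<close>, the fundamental groupoid of a path component is mapped to
  the fundamental group, so that words in paths with different end points can be computed in a group.
  The connecting path to \<open>a\<close> itself is constant, so that loops at \<open>a\<close> are mapped to their own classes.\<close>

definition connector :: "'a::topological_space set \<Rightarrow> 'a \<Rightarrow> 'a \<Rightarrow> real \<Rightarrow> 'a"
  where "connector S a x = (if x = a then (\<lambda>_. a)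
     else SOME g. path g \<and> path_image g \<subseteq> S \<and> pathstart g = a \<and> pathfinish g = x)"

definition path_at :: "'a::topological_space set \<Rightarrow> 'a \<Rightarrow> (real \<Rightarrow> 'a) \<Rightarrow> bool"
  where "path_at S a p \<longleftrightarrow> path p \<and> path_image p \<subseteq> S \<and> path_component S a (pathstart p)"

definition holonomy :: "'a::topological_space set \<Rightarrow> 'a \<Rightarrow> (real \<Rightarrow> 'a) \<Rightarrow> (real \<Rightarrow> 'a) set"
  where "holonomy S a p =
    path_class S (connector S a (pathstart p) +++ p +++ reversepath (connector S a (pathfinish p)))"

lemma path_at_finish:
  assumes "path_at S a p"
  shows "path_component S a (pathfinish p)"
  by (meson assms path_at_def path_component_def path_component_trans)

lemma connector:
  assumes "path_component S a x"
  shows "path (connector S a x)" "path_image (connector S a x) \<subseteq> S"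
    "pathstart (connector S a x) = a" "pathfinish (connector S a x) = x"
proof -
  have "a \<in> S"
    using assms path_component_mem(1) by blast
  moreover have "\<exists>g. path g \<and> path_image g \<subseteq> S \<and> pathstart g = a \<and> pathfinish g = x"
    using assms by (auto simp: path_component_def)
  note someI_ex [OF this]
  ultimately have "path (connector S a x) \<and> path_image (connector S a x) \<subseteq> S \<and>
    pathstart (connector S a x) = a \<and> pathfinish (connector S a x) = x"
    by (auto simp: connector_def path_def path_image_def pathstart_def pathfinish_def)
  then show "path (connector S a x)" "path_image (connector S a x) \<subseteq> S"
    "pathstart (connector S a x) = a" "pathfinish (connector S a x) = x" by auto
qed

lemma path_at_join:
  assumes "path_at S a p" "path_at S a q" "pathfinish p = pathstart q"
  shows "path_at S a (p +++ q)"
  using assms by (auto simp: path_at_def path_image_join)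

lemma path_at_reverse:
  assumes "path_at S a p"
  shows "path_at S a (reversepath p)"
  using assms path_at_finish [OF assms] by (auto simp: path_at_def)

lemma path_at_next:
  assumes "path_at S a p" "path q" "path_image q \<subseteq> S" "pathstart q = pathfinish p"
  shows "path_at S a q"
  using assms path_at_finish [OF assms(1)] by (auto simp: path_at_def)

lemma path_at_loops: "p \<in> loops_at S a \<Longrightarrow> path_at S a p"
  using pathstart_in_path_image [of p] by (auto simp: loops_at_def path_at_def path_component_refl_eq)

lemma holonomy_loop:
  assumes "path_at S a p"
  shows "connector S a (pathstart p) +++ p +++ reversepath (connector S a (pathfinish p)) \<in> loops_at S a"
  using assms connector [of S a "pathstart p"] connector [OF path_at_finish [OF assms]]
  by (auto simp: loops_at_def path_at_def path_image_join)

lemma holonomy_carrier: "path_at S a p \<Longrightarrow> holonomy S a p \<in> carrier (fundamental_group S a)"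
  using holonomy_loop by (auto simp: holonomy_def fundamental_group_def)

lemma holonomy_homotopic:
  assumes "homotopic_paths S p q" "path_at S a p"
  shows "holonomy S a p = holonomy S a q"
proof -
  have "pathstart q = pathstart p" "pathfinish q = pathfinish p"
    using homotopic_paths_imp_pathstart [OF assms(1)] homotopic_paths_imp_pathfinish [OF assms(1)] by auto
  then show ?thesis
    unfolding holonomy_def
    using assms connector [of S a "pathstart p"] connector [OF path_at_finish [OF assms(2)]]
    by (auto intro!: path_class_eq homotopic_paths_join simp: path_at_def)
qed

text \<open>Functoriality: the connecting path to the common end point occurs once reversed and once
  forwards and cancels. All other steps are rebracketing.\<close>

lemma holonomy_join:
  assumes p: "path_at S a p" and q: "path_at S a q" and pq: "pathfinish p = pathstart q"
  shows "holonomy S a (p +++ q) = holonomy S a p \<otimes>\<^bsub>fundamental_group S a\<^esub> holonomy S a q"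
proof -
  define f g h where "f = connector S a (pathstart p)" and "g = connector S a (pathfinish p)"
    and "h = reversepath (connector S a (pathfinish q))"
  note defs = f_def g_def h_def
  have f: "path f" "path_image f \<subseteq> S" "pathfinish f = pathstart p"
    using connector [of S a "pathstart p"] p by (auto simp: f_def path_at_def)
  have g: "path g" "path_image g \<subseteq> S" "pathfinish g = pathfinish p"
    using connector [OF path_at_finish [OF p]] by (auto simp: g_def)
  have h: "path h" "path_image h \<subseteq> S" "pathstart h = pathfinish q"
    using connector [OF path_at_finish [OF q]] by (auto simp: h_def)
  have p': "path p" "path_image p \<subseteq> S" and q': "path q" "path_image q \<subseteq> S"
    using p q by (auto simp: path_at_def)
  note facts = f g h p' q' pq
  have "homotopic_paths S ((f +++ p +++ reversepath g) +++ (g +++ q +++ h))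
       (((f +++ p) +++ reversepath g) +++ (g +++ q +++ h))"
    by (intro homotopic_paths_join homotopic_paths_assoc) (use facts in \<open>simp_all add: subset_path_image_join\<close>)
  also have "homotopic_paths S \<dots> ((f +++ p) +++ (reversepath g +++ (g +++ q +++ h)))"
    by (intro homotopic_paths_sym [OF homotopic_paths_assoc]) (use facts in \<open>simp_all add: subset_path_image_join\<close>)
  also have "homotopic_paths S \<dots> ((f +++ p) +++ ((reversepath g +++ g) +++ q +++ h))"
    by (intro homotopic_paths_join homotopic_paths_assoc) (use facts in \<open>simp_all add: subset_path_image_join\<close>)
  also have "homotopic_paths S \<dots> ((f +++ p) +++ ((\<lambda>_. pathstart q) +++ q +++ h))"
    using homotopic_join_reverse [of "reversepath g" S] facts
    by (intro homotopic_paths_join) (simp_all add: subset_path_image_join)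
  also have "homotopic_paths S \<dots> ((f +++ p) +++ (q +++ h))"
    by (rule homotopic_paths_join)
       (use homotopic_const_join [of "q +++ h" S] pathstart_def [of "\<lambda>_. pathstart q"] facts
         in \<open>simp_all add: subset_path_image_join\<close>)
  also have "homotopic_paths S \<dots> (f +++ (p +++ (q +++ h)))"
    by (intro homotopic_paths_sym [OF homotopic_paths_assoc]) (use facts in \<open>simp_all add: subset_path_image_join\<close>)
  also have "homotopic_paths S \<dots> (f +++ ((p +++ q) +++ h))"
    by (intro homotopic_paths_join homotopic_paths_assoc) (use facts in \<open>simp_all add: subset_path_image_join\<close>)
  finally have "path_class S ((f +++ p +++ reversepath g) +++ (g +++ q +++ h)) =
      path_class S (f +++ ((p +++ q) +++ h))"
    by (rule path_class_eq)
  with path_class_mult [OF holonomy_loop [OF p] holonomy_loop [OF q]] show ?thesis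
    by (simp add: holonomy_def defs pq)
qed

lemma holonomy_loops_at:
  assumes "p \<in> loops_at S a"
  shows "holonomy S a p = path_class S p"
proof -
  have p: "path p" "path_image p \<subseteq> S" "pathstart p = a" "pathfinish p = a" "a \<in> S"
    using assms pathstart_in_path_image [of p] by (auto simp: loops_at_def)
  have r: "reversepath (\<lambda>_. a) = (\<lambda>_. a)"
    by (simp add: reversepath_def)
  have c: "path (\<lambda>_::real. a)" "path_image (\<lambda>_. a) \<subseteq> S" "pathstart (\<lambda>_. a) = a"
    using p(5) by (auto simp: path_def path_image_def pathstart_def)
  have "homotopic_paths S ((\<lambda>_. a) +++ p +++ (\<lambda>_. a)) (p +++ (\<lambda>_. a))"
    using homotopic_const_join [of "p +++ (\<lambda>_. a)" S] p c by (simp add: subset_path_image_join)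
  also have "homotopic_paths S \<dots> p"
    using homotopic_join_const [of p S] p by simp
  finally show ?thesis
    unfolding holonomy_def using p r by (simp add: connector_def path_class_eq)
qed

lemma holonomy_const:
  assumes "path_component S a x"
  shows "holonomy S a (\<lambda>_. x) = \<one>\<^bsub>fundamental_group S a\<^esub>"
proof -
  note c = connector [OF assms]
  have x: "path (\<lambda>_::real. x)" "path_image (\<lambda>_. x) \<subseteq> S" "pathstart (\<lambda>_. x) = x" "pathfinish (\<lambda>_. x) = x"
    using path_component_mem(2) [OF assms]
    by (auto simp: path_def path_image_def pathstart_def pathfinish_def)
  have "homotopic_paths S (connector S a x +++ (\<lambda>_. x) +++ reversepath (connector S a x))
          (connector S a x +++ reversepath (connector S a x))"
    using homotopic_const_join [of "reversepath (connector S a x)" S] c x by (intro homotopic_paths_join) auto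
  also have "homotopic_paths S \<dots> (\<lambda>_. a)"
    using homotopic_join_reverse [of "connector S a x" S] c by simp
  finally show ?thesis
    by (simp add: holonomy_def x path_class_eq fundamental_group_def)
qed

lemma holonomy_reverse:
  assumes "path_at S a p"
  shows "holonomy S a (reversepath p) = inv\<^bsub>fundamental_group S a\<^esub> holonomy S a p"
proof -
  have "a \<in> S"
    using assms path_component_mem(1) by (auto simp: path_at_def)
  then interpret group "fundamental_group S a"
    by (rule fundamental_group_group)
  note r = path_at_reverse [OF assms]
  have p: "path p" "path_image p \<subseteq> S"
    using assms by (auto simp: path_at_def)
  have "holonomy S a (reversepath p +++ p) = holonomy S a (\<lambda>_. pathfinish p)"
    using homotopic_join_reverse [of "reversepath p" S] p path_at_join [OF r assms]
    by (intro holonomy_homotopic) auto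
  then have "holonomy S a (reversepath p) \<otimes>\<^bsub>fundamental_group S a\<^esub> holonomy S a p = \<one>\<^bsub>fundamental_group S a\<^esub>"
    using holonomy_join [OF r assms] holonomy_const [OF path_at_finish [OF assms]] by simp
  then show ?thesis
    using holonomy_carrier assms r by (intro inv_equality [symmetric]) auto
qed

text \<open>Solves the relation coming from a square for \<open>p\<close>. The holonomy turns
  \<open>h\<close> into an equation in a group, in which the factor of \<open>g\<close> can be moved
  to the other side.\<close>

lemma homotopic_paths_conjugate:
  assumes p: "p \<in> loops_at S a" and q: "q \<in> loops_at S b"
    and g: "path g" "path_image g \<subseteq> S" "pathstart g = a" "pathfinish g = b"
    and h: "homotopic_paths S (p +++ g) (g +++ q)"
  shows "homotopic_paths S p (g +++ q +++ reversepath g)"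
proof -
  have "a \<in> S"
    using p pathstart_in_path_image [of p] by (auto simp: loops_at_def)
  then interpret group "fundamental_group S a"
    by (rule fundamental_group_group)
  have ap: "path_at S a p"
    using path_at_loops [OF p] .
  have ag: "path_at S a g"
    using path_at_next [OF ap] g p by (auto simp: loops_at_def)
  have aq: "path_at S a q"
    using path_at_next [OF ag] g q by (auto simp: loops_at_def)
  have ar: "path_at S a (reversepath g)"
    using path_at_reverse [OF ag] .
  note ps = p [unfolded loops_at_def, simplified] q [unfolded loops_at_def, simplified]
  note c = holonomy_carrier [OF ap] holonomy_carrier [OF aq] holonomy_carrier [OF ag]
  have "holonomy S a (p +++ g) = holonomy S a (g +++ q)"
    by (rule holonomy_homotopic [OF h path_at_join [OF ap ag]]) (use ps g in auto)
  then have eq: "holonomy S a p \<otimes>\<^bsub>fundamental_group S a\<^esub> holonomy S a g = holonomy S a g \<otimes>\<^bsub>fundamental_group S a\<^esub> holonomy S a q"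
    using ps g by (simp add: holonomy_join ap ag aq)
  have l: "g +++ q +++ reversepath g \<in> loops_at S a"
    using ps g by (auto simp: loops_at_def path_image_join)
  have "holonomy S a (g +++ q +++ reversepath g) =
      holonomy S a g \<otimes>\<^bsub>fundamental_group S a\<^esub> (holonomy S a q \<otimes>\<^bsub>fundamental_group S a\<^esub> inv\<^bsub>fundamental_group S a\<^esub> holonomy S a g)"
    using ps g by (simp add: holonomy_join path_at_join ap ag aq ar holonomy_reverse)
  also have "\<dots> = holonomy S a p"
    using eq c by (simp flip: m_assoc) (simp add: m_assoc eq [symmetric])
  finally show ?thesis
    using holonomy_loops_at [OF p] holonomy_loops_at [OF l] ps path_class_eq_iff [of p S] by metis
qed

lemma (in group) inv_cancel:
  assumes "x \<in> carrier G" "y \<in> carrier G"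
  shows "inv x \<otimes> (x \<otimes> y) = y" "x \<otimes> (inv x \<otimes> y) = y"
  using assms by (simp_all add: m_assoc [symmetric])

text \<open>\<open>B1\<close>, \<open>B2\<close>, \<open>C1\<close>, \<open>C2\<close> stand for the
  successive quarters of the circle from angle \<open>pi\<close> to \<open>3 pi\<close>,
  \<open>D\<close> for the vertical diameter, \<open>A\<close> for the turn of \<open>z\<close>,
  \<open>b\<close> and \<open>b'\<close> for the boundaries of the left and right half disc, and
  \<open>q\<close> for the trace of the half turn. Replacing the last \<open>inv A\<close> by
  \<open>q C1 C2\<close> lets \<open>bq\<close> trade \<open>b\<close> for \<open>b'\<close>; then
  \<open>A\<close> cancels, and so do the two passages of \<open>D\<close>.\<close>

lemma (in group) half_twist_word:
  assumes car: "A \<in> carrier G" "B1 \<in> carrier G" "B2 \<in> carrier G" "C1 \<in> carrier G" "C2 \<in> carrier G" "D \<in> carrier G"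
    and b: "b = B1 \<otimes> (D \<otimes> C2)" and b': "b' = C1 \<otimes> (inv D \<otimes> B2)"
    and q: "q = inv A \<otimes> (inv C2 \<otimes> inv C1)" and bq: "b \<otimes> q = q \<otimes> b'"
  shows "b \<otimes> (A \<otimes> (b \<otimes> inv A)) = B1 \<otimes> (B2 \<otimes> (C1 \<otimes> C2))"
proof -
  note simps = m_assoc inv_cancel inv_mult_group
  have c: "b \<in> carrier G" "b' \<in> carrier G" "q \<in> carrier G"
    using car by (simp_all add: b b' q)
  have "inv A = q \<otimes> (C1 \<otimes> C2)"
    using car by (simp add: q simps)
  then have "A \<otimes> (b \<otimes> inv A) = A \<otimes> ((b \<otimes> q) \<otimes> (C1 \<otimes> C2))"
    using car c by (simp add: m_assoc)
  also have "\<dots> = inv C2 \<otimes> (inv D \<otimes> (B2 \<otimes> (C1 \<otimes> C2)))"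
    unfolding bq using car by (simp add: q b' simps)
  finally show ?thesis
    using car by (simp add: b simps)
qed

section \<open>Lassos in the plane\<close>

text \<open>\<open>lasso\<close> with a free real starting point, so that the same facts serve in
  several coordinates. The circle begins at angle \<open>pi\<close> because the segment arrives from
  the left.\<close>

definition real_lasso :: "real \<Rightarrow> real \<Rightarrow> real \<Rightarrow> real \<Rightarrow> complex"
  where "real_lasso a c r =
    linepath (of_real a) (of_real (c - r)) +++
    part_circlepath (of_real c) r pi (3 * pi) +++
    linepath (of_real (c - r)) (of_real a)"

definition strip :: "real \<Rightarrow> real \<Rightarrow> real \<Rightarrow> complex set"
  where "strip a b h = cbox (Complex a (-h)) (Complex b h)"

lemma mem_strip: "z \<in> strip a b h \<longleftrightarrow> a \<le> Re z \<and> Re z \<le> b \<and> \<bar>Im z\<bar> \<le> h"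
  by (auto simp: strip_def in_cbox_complex_iff)

lemma strip_convex: "convex (strip a b h)" and strip_closed: "closed (strip a b h)"
  by (simp_all add: strip_def closed_cbox)

lemma strip_interior: "z \<in> interior (strip a b h) \<longleftrightarrow> a < Re z \<and> Re z < b \<and> \<bar>Im z\<bar> < h"
  by (auto simp: strip_def interior_cbox in_box_complex_iff)

lemma cis_pi3: "exp (\<i> * (of_real pi * 3)) = -1"
proof -
  have eq: "\<i> * (of_real pi * 3) = of_real pi * \<i> + 2 * of_real pi * \<i>"
    by (simp add: algebra_simps)
  show ?thesis
    unfolding eq exp_add exp_pi_i exp_two_pi_i by simp
qed

lemma part_circlepath_ends:
  "pathstart (part_circlepath c r pi (3 * pi)) = c - of_real r"
  "pathfinish (part_circlepath c r pi (3 * pi)) = c - of_real r"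
  using exp_pi_i by (simp_all add: cis_pi3 mult_ac)

lemma part_circlepath_image: "r \<ge> 0 \<Longrightarrow> path_image (part_circlepath c r a b) \<subseteq> sphere c r"
  by (auto simp: path_image_def part_circlepath_def dist_norm norm_mult)

lemma real_linepath_image:
  assumes "a \<le> b"
  shows "path_image (linepath (complex_of_real a) (of_real b)) = of_real ` {a..b}"
    and "path_image (linepath (complex_of_real b) (of_real a)) = of_real ` {a..b}"
  using assms by (simp_all add: closed_segment_of_real closed_segment_eq_real_ivl)

lemma real_lasso_path [simp]:
  "path (real_lasso a c r)"
  "pathstart (real_lasso a c r) = of_real a" "pathfinish (real_lasso a c r) = of_real a"
  by (auto simp: real_lasso_def part_circlepath_ends simp del: pathstart_part_circlepath pathfinish_part_circlepath)

lemma real_lasso_image: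
  assumes "0 < r" "a \<le> c - r"
  shows "path_image (real_lasso a c r) = of_real ` {a..c - r} \<union> path_image (part_circlepath (of_real c) r pi (3 * pi))"
proof -
  have j: "path_image (f +++ k +++ g) = path_image f \<union> path_image k \<union> path_image g"
    if "pathfinish f = pathstart k" "pathfinish k = pathstart g" for f k g :: "real \<Rightarrow> complex"
    using that by (auto simp: path_image_join)
  show ?thesis
    unfolding real_lasso_def
    by (subst j) (use part_circlepath_ends real_linepath_image [OF assms(2)] in \<open>auto simp flip: of_real_diff\<close>)
qed

lemma real_lasso_image_subset:
  assumes "0 < r" "a \<le> c - r"
  shows "path_image (real_lasso a c r) \<subseteq> of_real ` {a..c - r} \<union> sphere (of_real c) r"
  using part_circlepath_image [of r "of_real c" pi "3 * pi"] assms unfolding real_lasso_image [OF assms] by auto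

text \<open>Relative to its centre the circle is \<open>exp\<close> of a vertical segment of length
  \<open>2 pi\<close>.\<close>

lemma winding_number_part_circlepath:
  assumes "0 < r"
  shows "winding_number (part_circlepath c r pi (3 * pi)) c = 1"
proof -
  define l where "l = linepath (of_real (ln r) + \<i> * of_real pi) (of_real (ln r) + \<i> * of_real (3 * pi))"
  have "winding_number (part_circlepath c r pi (3 * pi)) c = winding_number (\<lambda>t. part_circlepath c r pi (3 * pi) t - c) 0"
    by (rule winding_number_offset)
  also have "(\<lambda>t. part_circlepath c r pi (3 * pi) t - c) = exp \<circ> l"
  proof
    fix t
    have "l t = of_real (ln r) + \<i> * linepath (of_real pi) (of_real (3 * pi)) t"
      by (simp add: l_def linepath_def algebra_simps)
    then show "part_circlepath c r pi (3 * pi) t - c = (exp \<circ> l) t"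
      using assms by (simp add: part_circlepath_def exp_add linepath_def exp_of_real scaleR_conv_of_real)
  qed
  also have "winding_number (exp \<circ> l) 0 = (pathfinish l - pathstart l) / (2 * of_real pi * \<i>)"
    by (rule winding_number_compose_exp) (simp add: l_def)
  also have "\<dots> = 1"
    by (simp add: l_def field_simps)
  finally show ?thesis .
qed

text \<open>Passing from the centre \<open>c\<close> to \<open>w\<close> multiplies the path by
  \<open>1 - (w - c) / (k - c)\<close>, where \<open>k\<close> runs on the circle. The quotient has
  modulus below 1, so this factor lies in the right half plane.\<close>

lemma winding_number_circle:
  assumes "norm (w - c) < r"
  shows "winding_number (part_circlepath c r pi (3 * pi)) w = 1"
proof -
  have r: "0 < r"
    using assms norm_ge_zero le_less_trans by blast
  let ?k = "part_circlepath c r pi (3 * pi)"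
  have k: "norm (?k t - c) = r" if "t \<in> {0..1}" for t
    using part_circlepath_image [of r c pi "3 * pi"] that r by (force simp: path_image_def dist_norm norm_minus_commute)
  define g where "g = (\<lambda>t. 1 - (w - c) / (?k t - c))"
  have "winding_number ?k w = winding_number (\<lambda>t. ?k t - w) 0"
    by (rule winding_number_offset)
  also have "\<dots> = winding_number (\<lambda>t. (?k t - c) * g t) 0"
  proof (rule winding_number_cong)
    fix t :: real assume "0 \<le> t" "t \<le> 1"
    then have "?k t - c \<noteq> 0"
      using k [of t] r by auto
    then show "?k t - w = (?k t - c) * g t"
      by (simp add: g_def field_simps)
  qed
  also have "\<dots> = winding_number (\<lambda>t. ?k t - c) 0"
  proof (rule winding_number_mult_halfplane)
    show pk: "path (\<lambda>t. ?k t - c)"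
      using path_part_circlepath unfolding path_def by (intro continuous_intros)
    show "0 \<notin> path_image (\<lambda>t. ?k t - c)"
      using k r by (force simp: path_image_def)
    show "path g"
      unfolding path_def g_def
      by (rule continuous_on_diff [OF continuous_on_const continuous_on_divide [OF continuous_on_const pk [unfolded path_def]]])
         (use k r in force)
    show "pathfinish g = pathstart g"
      using part_circlepath_ends [of c r] by (simp add: g_def pathfinish_def pathstart_def)
    fix t :: real assume t: "t \<in> {0..1}"
    have "norm ((w - c) / (?k t - c)) < 1"
      using k [OF t] assms r by (simp add: norm_divide)
    then show "Re (g t) > 0"
      unfolding g_def using complex_Re_le_cmod le_less_trans by fastforce
  qed
  also have "\<dots> = 1"
    using winding_number_part_circlepath [OF r, of c] winding_number_offset [of ?k c] by simp
  finally show ?thesis .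
qed

lemma winding_number_real_lasso:
  assumes "0 < r" "a \<le> c - r"
  shows "winding_number (real_lasso a c r) (of_real c) = 1"
proof -
  let ?l = "linepath (complex_of_real a) (of_real (c - r))"
  have im: "path_image ?l = of_real ` {a..c - r}"
    by (rule real_linepath_image) fact
  have l: "of_real c \<notin> path_image ?l"
    unfolding im using assms by (auto simp flip: of_real_diff)
  have k: "of_real c \<notin> path_image (part_circlepath (of_real c) r pi (3 * pi))"
    using part_circlepath_image [of r "of_real c" pi "3 * pi"] assms by auto
  have r: "linepath (complex_of_real (c - r)) (of_real a) = reversepath ?l"
    by simp
  show ?thesis
    unfolding real_lasso_def r
    using l k winding_number_part_circlepath [OF assms(1), of "of_real c"]
    by (simp add: winding_number_join winding_number_reversepath part_circlepath_ends not_in_path_image_join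
        del: pathstart_part_circlepath pathfinish_part_circlepath path_image_linepath reversepath_linepath)
qed

lemma real_lasso_box:
  assumes "0 < r" "a \<le> c - r" "p \<in> path_image (real_lasso a c r)"
  shows "p \<noteq> of_real c \<and> a \<le> Re p \<and> Re p \<le> c + r \<and> \<bar>Im p\<bar> \<le> r"
proof -
  consider x where "p = of_real x" "a \<le> x" "x \<le> c - r" | "cmod (p - of_real c) = r"
    using real_lasso_image_subset [OF assms(1,2)] assms(3) by (auto simp: dist_norm norm_minus_commute)
  then show ?thesis
  proof cases
    case 1
    then show ?thesis
      using assms(1,2) by auto
  next
    case 2
    then show ?thesis
      using assms(1,2) abs_Re_le_cmod [of "p - of_real c"] abs_Im_le_cmod [of "p - of_real c"] by auto
  qed
qed

section \<open>The last generator\<close>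

lemma lasso_eq_real_lasso: "lasso c r = real_lasso 1 c r"
  by (simp add: lasso_def real_lasso_def)

lemma continuous_line_point: "continuous_on A (line_point n \<epsilon>)"
  by (rule continuous_on_coordinatewise_then_product) (auto simp: line_point_def intro!: continuous_intros)

lemma nearest_param_gt_4:
  assumes "0 < (\<Sum>j\<in>{1..n}. sqrt (\<epsilon> j))" "(\<Sum>j\<in>{1..n}. sqrt (\<epsilon> j)) < 1 / 2"
  shows "4 < nearest_param n \<epsilon>"
proof -
  have "(\<Sum>j\<in>{1..n}. sqrt (\<epsilon> j))\<^sup>2 < (1 / 2)\<^sup>2"
    using assms by (intro power_strict_mono) auto
  then show ?thesis
    using assms(1) by (simp add: nearest_param_def field_simps power2_eq_square)
qed

text \<open>All zeros of \<open>Rpoly\<close> on the line are positive reals, and none is nearer to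
  1 than \<open>nearest_param\<close>; hence none lies to the left of it. Those at most
  \<open>r\<close> to its right would lie in the disc controlled by
  \<open>small_radius\<close>.\<close>

lemma line_point_Xspace:
  assumes n: "n \<ge> 1" "\<forall>j\<in>{1..n}. 0 < \<epsilon> j" and S: "(\<Sum>j\<in>{1..n}. sqrt (\<epsilon> j)) < 1 / 2"
    and sr: "small_radius n \<epsilon> r"
    and t: "t \<noteq> 0" "t \<noteq> of_real (nearest_param n \<epsilon>)" "Re t \<le> nearest_param n \<epsilon> + r"
  shows "line_point n \<epsilon> t \<in> Xspace n"
proof -
  let ?c = "nearest_param n \<epsilon>"
  have "0 < (\<Sum>j\<in>{1..n}. sqrt (\<epsilon> j))"
    using n by (intro sum_pos) auto
  then have c: "4 < ?c" "0 < r"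
    using sr S by (auto simp: small_radius_def nearest_param_gt_4)
  have "Rpoly n (line_point n \<epsilon> t) \<noteq> 0"
  proof
    assume R: "Rpoly n (line_point n \<epsilon> t) = 0"
    then obtain \<sigma> :: "nat \<Rightarrow> real" where s: "t * of_real ((\<Sum>j\<in>{1..n}. \<sigma> j * sqrt (\<epsilon> j))\<^sup>2) = 1"
      unfolding Rpoly_line_point [OF n(2)] by blast
    define x where "x = 1 / (\<Sum>j\<in>{1..n}. \<sigma> j * sqrt (\<epsilon> j))\<^sup>2"
    have "complex_of_real ((\<Sum>j\<in>{1..n}. \<sigma> j * sqrt (\<epsilon> j))\<^sup>2) \<noteq> 0"
      using s by (metis mult_zero_right zero_neq_one)
    then have tx: "t = of_real x"
      using s by (simp add: x_def eq_divide_eq)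
    have x0: "0 \<le> x"
      by (simp add: x_def)
    have d: "dist 1 (complex_of_real u) = \<bar>1 - u\<bar>" for u
      using dist_of_real [of 1 u, where ?'a = complex] by (simp add: dist_real_def)
    have "\<bar>1 - ?c\<bar> \<le> \<bar>1 - x\<bar>"
      using nearest_param_nearest(2) [OF n _ R] S unfolding tx d by simp
    moreover have "x \<le> ?c + r"
      using t(3) tx by simp
    moreover have "x \<noteq> ?c"
      using t(2) tx by auto
    ultimately have "t \<in> cball (of_real ?c) r - {of_real ?c}"
      unfolding tx using c x0 by (simp add: dist_of_real dist_real_def)
    then have "line_point n \<epsilon> t \<in> Xspace n"
      using sr by (auto simp: small_radius_def)
    with R show False
      by (simp add: Xspace_def Sset_def)
  qed
  moreover have "(\<Prod>j\<in>{1..n}. line_point n \<epsilon> t j) \<noteq> 0"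
    using n(2) t(1) by (force simp: line_point_def basept_def)
  ultimately show ?thesis
    by (simp add: Xspace_def Sset_def cspace_def line_point_def basept_def)
qed

text \<open>The left edge \<open>1/2\<close> keeps the rectangle away from \<open>t = 0\<close>,
  where all coordinates vanish.\<close>

lemma lasso_image_strip:
  assumes "0 < r" "r < c - 1"
  shows "path_image (lasso c r) \<subseteq> strip (1/2) (c + r) r - {of_real c}"
proof -
  have "\<bar>Re (z - of_real c)\<bar> \<le> r \<and> \<bar>Im (z - of_real c)\<bar> \<le> r" if "z \<in> sphere (of_real c) r" for z
    using that abs_Re_le_cmod [of "z - of_real c"] abs_Im_le_cmod [of "z - of_real c"]
    by (auto simp: dist_norm norm_minus_commute)
  then have "sphere (of_real c) r \<subseteq> strip (1/2) (c + r) r - {of_real c}"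
    using assms by (force simp: mem_strip)
  moreover have "of_real ` {1..c - r} \<subseteq> strip (1/2) (c + r) r - {complex_of_real c}"
    using assms by (auto simp: mem_strip simp flip: of_real_diff)
  ultimately show ?thesis
    using real_lasso_image_subset [of r 1 c] assms unfolding lasso_eq_real_lasso by fastforce
qed

lemma rho_last_loop:
  assumes n: "n \<ge> 1" "\<forall>j\<in>{1..n}. 0 < \<epsilon> j" and S: "(\<Sum>j\<in>{1..n}. sqrt (\<epsilon> j)) < 1 / 2"
    and sr: "small_radius n \<epsilon> r"
  shows "rho_last n \<epsilon> r \<in> loops_at (Xspace n) (basept n \<epsilon>)"
proof -
  let ?c = "nearest_param n \<epsilon>"
  have "path_image (lasso ?c r) \<subseteq> strip (1/2) (?c + r) r - {of_real ?c}"
    using sr by (intro lasso_image_strip) (auto simp: small_radius_def)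
  moreover have "line_point n \<epsilon> t \<in> Xspace n" if "t \<in> strip (1/2) (?c + r) r - {of_real ?c}" for t
    using that by (intro line_point_Xspace [OF n S sr]) (auto simp: mem_strip)
  ultimately have "path_image (rho_last n \<epsilon> r) \<subseteq> Xspace n"
    by (auto simp: rho_last_def path_image_compose)
  moreover have "path (rho_last n \<epsilon> r)"
    unfolding rho_last_def by (rule path_continuous_image) (auto simp: lasso_eq_real_lasso continuous_line_point)
  moreover have "line_point n \<epsilon> 1 = basept n \<epsilon>"
    by (simp add: line_point_def)
  ultimately show ?thesis
    by (simp add: loops_at_def rho_last_def pathstart_compose pathfinish_compose lasso_eq_real_lasso)
qed

text \<open>In the coordinate \<open>p = S \<surd>t - 1\<close>, where \<open>S\<close> is the sum of the square roots of the base point, the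
  nearest point of the line is \<open>p = 0\<close> and \<open>t - c = p (p + 2) / S\<^sup>2\<close>.\<close>

lemma rho_last_homotopic:
  fixes n \<epsilon>
  defines "S \<equiv> (\<Sum>j\<in>{1..n}. sqrt (\<epsilon> j))"
  assumes n: "n \<ge> 1" "\<forall>j\<in>{1..n}. 0 < \<epsilon> j" and S: "S < 1 / 2"
    and sr: "small_radius n \<epsilon> r"
    and \<rho>: "0 < \<rho>" "\<rho> \<le> S / 2" "\<rho> \<le> r * S\<^sup>2 / 3"
  shows "homotopic_paths (Xspace n) (rho_last n \<epsilon> r)
     ((\<lambda>p. line_point n \<epsilon> (((1 + p) / of_real S)\<^sup>2)) \<circ> real_lasso (S - 1) 0 \<rho>)"
proof -
  let ?c = "nearest_param n \<epsilon>"
  let ?q = "real_lasso (S - 1) 0 \<rho>"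
  let ?sq = "\<lambda>p. ((1 + p) / of_real S)\<^sup>2"
  have S0: "0 < S"
    using n unfolding S_def by (intro sum_pos) auto
  have c: "4 < ?c" "?c = 1 / S\<^sup>2"
    using nearest_param_gt_4 [of \<epsilon> n] S0 S unfolding S_def by (auto simp: nearest_param_def)
  have r: "0 < r" "r < ?c - 1"
    using sr by (auto simp: small_radius_def)
  \<comment> \<open>The first summand bounds the imaginary part of the squared lasso, the second
    leaves room for the original one.\<close>
  define h where "h = 4 / S\<^sup>2 + r"
  define A where "A = strip (1/2) (?c + r) h"
  have h: "r < h" "4 / S\<^sup>2 < h"
    using S0 r by (auto simp: h_def)
  have q: "p \<noteq> 0 \<and> -1 < Re p \<and> Re p \<le> \<rho> \<and> \<bar>Im p\<bar> \<le> \<rho> \<and> (Im p = 0 \<and> S - 1 \<le> Re p \<or> cmod p = \<rho>)"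
    if "p \<in> path_image ?q" for p
  proof -
    have "p \<in> of_real ` {S - 1..0 - \<rho>} \<union> sphere (of_real 0) \<rho>"
      using real_lasso_image_subset [of \<rho> "S - 1" 0] that S \<rho> by auto
    then show ?thesis
      using S0 S \<rho> abs_Re_le_cmod [of p] abs_Im_le_cmod [of p] by auto
  qed
  have sq_A: "?sq p \<in> A - {of_real ?c}" if "p \<in> path_image ?q" for p
  proof -
    note p = q [OF that]
    define x y where "x = Re p" and "y = Im p"
    have xy: "-1 < x" "x \<le> \<rho>" "\<bar>y\<bar> \<le> \<rho>" "y = 0 \<and> S - 1 \<le> x \<or> cmod p = \<rho>"
      using p by (auto simp: x_def y_def)
    have xr: "\<bar>x\<bar> \<le> \<rho>" if "cmod p = \<rho>"
      using abs_Re_le_cmod [of p] that by (simp add: x_def)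
    have y2: "y\<^sup>2 \<le> \<rho>\<^sup>2"
      using xy(3) power_mono [of "\<bar>y\<bar>" \<rho> 2] by simp
    have "?sq p = (1 + p)\<^sup>2 / of_real (S\<^sup>2)"
      by (simp add: power_divide)
    then have R: "Re (?sq p) = ((1 + x)\<^sup>2 - y\<^sup>2) / S\<^sup>2" and I: "Im (?sq p) = 2 * (1 + x) * y / S\<^sup>2"
      by (simp_all add: x_def y_def Re_divide_of_real Im_divide_of_real Re_power2 Im_power2 del: of_real_power)
    \<comment> \<open>This is \<open>Re t \<ge> 1/2\<close>. On the tail \<open>y = 0\<close> and
      \<open>1 + x \<ge> S\<close>; on the circle \<open>1 + x \<ge> 1/2 > S\<close>, while
      \<open>y^2 \<le> S^2 / 4\<close>.\<close>
    have lo: "S\<^sup>2 / 2 \<le> (1 + x)\<^sup>2 - y\<^sup>2"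
    proof (cases "cmod p = \<rho>")
      case True
      have "(1/2)\<^sup>2 \<le> (1 + x)\<^sup>2"
        using xr [OF True] S \<rho> by (intro power_mono) auto
      moreover have "S\<^sup>2 \<le> (1/2)\<^sup>2" "\<rho>\<^sup>2 \<le> (S/2)\<^sup>2"
        using S S0 \<rho> by (auto intro!: power_mono)
      ultimately show ?thesis
        using y2 by (simp add: power_divide)
    next
      case False
      then have "S\<^sup>2 \<le> (1 + x)\<^sup>2" "y = 0"
        using xy S0 by (auto intro!: power_mono)
      then show ?thesis
        using zero_le_power2 [of S] by (simp only: zero_power2)
    qed
    have "(1 + x)\<^sup>2 \<le> (1 + \<rho>)\<^sup>2"
      using xy by (intro power_mono) auto
    \<comment> \<open>Valid since \<open>\<rho> \<le> 1\<close>. The hypothesis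
      \<open>\<rho> \<le> r S^2 / 3\<close> is made for the next step: it keeps \<open>Re t\<close>
      below \<open>c + r\<close>.\<close>
    also have "\<dots> \<le> 1 + 3 * \<rho>"
      using \<rho> S by (simp add: power2_eq_square algebra_simps)
    also have "\<dots> \<le> 1 + r * S\<^sup>2"
      using \<rho> by simp
    finally have hi: "(1 + x)\<^sup>2 - y\<^sup>2 \<le> 1 + r * S\<^sup>2"
      using zero_le_power2 [of y] by linarith
    have "\<bar>2 * (1 + x) * y\<bar> = 2 * (1 + x) * \<bar>y\<bar>"
      using xy by (simp add: abs_mult)
    also have "\<dots> \<le> 2 * 2 * 1"
      using xy \<rho> S by (intro mult_mono) auto
    finally have im: "\<bar>2 * (1 + x) * y / S\<^sup>2\<bar> \<le> 4 / S\<^sup>2"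
      using S0 by (simp add: abs_mult divide_right_mono)
    have "1 / 2 \<le> ((1 + x)\<^sup>2 - y\<^sup>2) / S\<^sup>2"
      using lo S0 by (subst pos_le_divide_eq) auto
    moreover have "((1 + x)\<^sup>2 - y\<^sup>2) / S\<^sup>2 \<le> ?c + r"
      unfolding c(2) using hi S0 by (subst pos_divide_le_eq) (auto simp: distrib_right)
    ultimately have "?sq p \<in> A"
      unfolding A_def mem_strip R I using im h by simp
    moreover have "?sq p \<noteq> of_real ?c"
    proof
      assume "?sq p = of_real ?c"
      then have "(1 + p)\<^sup>2 = 1"
        using S0 c(2) by (simp add: power_divide)
      then have "1 + p = 1 \<or> 1 + p = -1"
        by (simp add: power2_eq_1_iff)
      then show False
        using p by (auto simp: complex_eq_iff)
    qed
    ultimately show ?thesis by simp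
  qed
  have psq: "path (?sq \<circ> ?q)"
    using S0 by (intro path_continuous_image) (auto intro!: continuous_intros)
  have wn: "winding_number (?sq \<circ> ?q) (of_real ?c) = 1"
  proof -
    have "winding_number (?sq \<circ> ?q) (of_real ?c) = winding_number (\<lambda>t. (?sq \<circ> ?q) t - of_real ?c) 0"
      by (rule winding_number_offset)
    also have "(\<lambda>t. (?sq \<circ> ?q) t - of_real ?c) = (\<lambda>t. ?q t * ((2 + ?q t) / of_real (S\<^sup>2)))"
    proof
      fix t
      have "(1 + ?q t)\<^sup>2 / of_real (S\<^sup>2) - 1 / of_real (S\<^sup>2) = ?q t * ((2 + ?q t) / of_real (S\<^sup>2))"
        unfolding diff_divide_distrib [symmetric] times_divide_eq_right
        by (simp add: power2_eq_square algebra_simps)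
      then show "(?sq \<circ> ?q) t - of_real ?c = ?q t * ((2 + ?q t) / of_real (S\<^sup>2))"
        by (simp add: c(2) power_divide)
    qed
    \<comment> \<open>The second factor has positive real part because \<open>Re p > -1\<close> on
      the lasso.\<close>
    also have "winding_number \<dots> 0 = winding_number ?q 0"
    proof (rule winding_number_mult_halfplane)
      show "path (\<lambda>t. (2 + ?q t) / of_real (S\<^sup>2))"
        using real_lasso_path(1) [of "S - 1" 0 \<rho>] S0 unfolding path_def by (intro continuous_intros) auto
      show "Re ((2 + ?q t) / of_real (S\<^sup>2)) > 0" if "t \<in> {0..1}" for t
        using q [of "?q t"] that S0 by (simp add: path_image_def Re_divide_of_real del: of_real_power)
      show "pathfinish (\<lambda>t. (2 + ?q t) / of_real (S\<^sup>2)) = pathstart (\<lambda>t. (2 + ?q t) / of_real (S\<^sup>2))"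
        using real_lasso_path(2,3) [of "S - 1" 0 \<rho>] unfolding pathstart_def pathfinish_def by simp
    qed (use q in auto)
    also have "\<dots> = 1"
      using winding_number_real_lasso [of \<rho> "S - 1" 0] \<rho> S by simp
    finally show ?thesis .
  qed
  have "homotopic_paths (A - {of_real ?c}) (lasso ?c r) (?sq \<circ> ?q)"
  proof (rule homotopic_paths_punctured_convex)
    show "convex A" "closed A"
      by (simp_all add: A_def strip_convex strip_closed)
    show "complex_of_real ?c \<in> interior A"
      unfolding A_def strip_interior using c(1) r h(1) by simp
    show "path (lasso ?c r)"
      by (simp add: lasso_eq_real_lasso)
    show "path_image (lasso ?c r) \<subseteq> A - {of_real ?c}"
    proof -
      have "strip (1/2) (?c + r) r \<subseteq> A"
        using h(1) by (auto simp: A_def mem_strip)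
      then show ?thesis
        by (intro order_trans [OF lasso_image_strip [OF r]] Diff_mono order_refl)
    qed
    show "path (?sq \<circ> ?q)" by (rule psq)
    show "path_image (?sq \<circ> ?q) \<subseteq> A - {of_real ?c}"
      unfolding path_image_compose by (intro image_subsetI sq_A)
    show "pathstart (?sq \<circ> ?q) = pathstart (lasso ?c r)" "pathfinish (?sq \<circ> ?q) = pathfinish (lasso ?c r)"
      using S0 by (auto simp: pathstart_compose pathfinish_compose lasso_eq_real_lasso)
    show "winding_number (lasso ?c r) (of_real ?c) = winding_number (?sq \<circ> ?q) (of_real ?c)"
      using winding_number_real_lasso [of r 1 ?c] r wn by (simp add: lasso_eq_real_lasso)
  qed
  moreover have "line_point n \<epsilon> t \<in> Xspace n" if "t \<in> A - {of_real ?c}" for t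
    using that by (intro line_point_Xspace [OF n S [unfolded S_def] sr]) (auto simp: A_def mem_strip)
  ultimately have "homotopic_paths (Xspace n) (line_point n \<epsilon> \<circ> lasso ?c r) (line_point n \<epsilon> \<circ> (?sq \<circ> ?q))"
    by (intro homotopic_paths_continuous_image [OF _ continuous_line_point]) auto
  then show ?thesis
    by (simp add: rho_last_def comp_def)
qed

section \<open>A chart near the base point\<close>

text \<open>These inequalities are all that is used of the choice of the base point. The bound
  \<open>1/2\<close> gives \<open>s < 1/2\<close> and \<open>6 e < 1\<close>, so the base point
  \<open>y = s - 1\<close> lies outside the circle of radius \<open>2 e\<close>. The factor 4 gives
  \<open>2 e < sqrt (\<epsilon> j)\<close>, which separates the factors of
  \<open>Rpoly\<close>.\<close>

locale small_base =
  fixes m :: nat and \<epsilon> :: "nat \<Rightarrow> real"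
  assumes m: "2 \<le> m"
    and pos: "\<forall>j\<in>{1..m}. 0 < \<epsilon> j"
    and small: "(\<Sum>j\<in>{1..m}. sqrt (\<epsilon> j)) < 1 / 2"
    and last: "\<forall>j\<in>{1..m-1}. 4 * \<epsilon> m < \<epsilon> j"
begin

definition e :: real where "e = sqrt (\<epsilon> m)"

definition s :: real where "s = (\<Sum>j\<in>{1..m-1}. sqrt (\<epsilon> j))"

lemma sum_split: "(\<Sum>j\<in>{1..m}. f j) = (\<Sum>j\<in>{1..m-1}. f j) + f m" for f :: "nat \<Rightarrow> 'b::comm_monoid_add"
proof -
  have "{1..m} = insert m {1..m-1}"
    using m by auto
  then show ?thesis
    using m by (simp add: add.commute)
qed

lemma e_pos: "0 < e" and e_sq: "e\<^sup>2 = \<epsilon> m"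
proof -
  have "0 < \<epsilon> m"
    using pos m by simp
  then show "0 < e" "e\<^sup>2 = \<epsilon> m"
    by (simp_all add: e_def)
qed

lemma two_e: "2 * e < sqrt (\<epsilon> j)" if "j \<in> {1..m-1}"
proof -
  have "sqrt (4 * \<epsilon> m) < sqrt (\<epsilon> j)"
    using last that by (subst real_sqrt_less_iff) blast
  then show ?thesis
    by (simp add: e_def real_sqrt_mult)
qed

lemma s_e: "(\<Sum>j\<in>{1..m}. sqrt (\<epsilon> j)) = s + e" "s + e < 1 / 2"
  using small unfolding sum_split by (simp_all add: s_def e_def)

lemma two_e_s: "2 * e < s"
proof -
  have "2 * e < sqrt (\<epsilon> 1)"
    using m by (intro two_e) auto
  also have "\<dots> \<le> s"
    unfolding s_def using m pos by (intro member_le_sum) (auto simp: less_imp_le)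
  finally show ?thesis .
qed

text \<open>Parametrised by \<open>w\<close> instead of \<open>w^2\<close>, so that
  \<open>w * sqrt (\<epsilon> j)\<close> is a square root of the coordinate \<open>j\<close> and the
  factors of \<open>Rpoly\<close> are linear in \<open>w\<close> and a root of
  \<open>z\<close>.\<close>

definition pt :: "complex \<Rightarrow> complex \<Rightarrow> nat \<Rightarrow> complex"
  where "pt w z = (\<lambda>j. if j \<in> {1..m-1} then w\<^sup>2 * of_real (\<epsilon> j) else if j = m then z else 0)"

lemma continuous_on_pt:
  assumes "continuous_on A f" "continuous_on A g"
  shows "continuous_on A (\<lambda>x. pt (f x) (g x))"
proof (rule continuous_on_coordinatewise_then_product)
  fix i
  show "continuous_on A (\<lambda>x. pt (f x) (g x) i)"
    using assms by (cases "i \<in> {1..m-1}"; cases "i = m") (auto simp: pt_def intro!: continuous_intros)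
qed

text \<open>The factor of \<open>R\<^sub>m\<close> in which \<open>\<surd>x\<^sub>j\<close> (\<open>j < m\<close>) all occur with sign \<open>-\<close> gives the branch
  \<open>(s w - 1)\<^sup>2 = z\<close>; in all other factors the real part of \<open>1 + w \<Sum>\<sigma>\<^sub>j \<surd>\<epsilon>\<^sub>j\<close> exceeds that of \<open>\<surd>z\<close>.\<close>

lemma Rpoly_pt:
  assumes v: "v\<^sup>2 = z" and z: "(of_real s * w - 1)\<^sup>2 \<noteq> z"
    and w: "0 < Re w" and b: "\<bar>Re v\<bar> < 1 - s * Re w + 4 * e * Re w"
  shows "Rpoly m (pt w z) \<noteq> 0"
proof
  assume "Rpoly m (pt w z) = 0"
  define \<omega> where "\<omega> j = (if j = m then v else w * of_real (sqrt (\<epsilon> j)))" for j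
  have "\<forall>j\<in>{1..m}. (\<omega> j)\<^sup>2 = pt w z j"
  proof
    fix j assume j: "j \<in> {1..m}"
    then have "0 < \<epsilon> j"
      using pos by blast
    then have "(complex_of_real (sqrt (\<epsilon> j)))\<^sup>2 = of_real (\<epsilon> j)"
      by (simp flip: of_real_power)
    then show "(\<omega> j)\<^sup>2 = pt w z j"
      using j m v by (auto simp: \<omega>_def pt_def power_mult_distrib)
  qed
  from \<open>Rpoly m (pt w z) = 0\<close> obtain \<sigma>
    where \<sigma>: "\<sigma> \<in> {1..m} \<rightarrow>\<^sub>E {1, -1}" and eq: "1 + (\<Sum>j\<in>{1..m}. \<sigma> j * \<omega> j) = 0"
    unfolding Rpoly_eq_0_iff [OF \<open>\<forall>j\<in>{1..m}. (\<omega> j)\<^sup>2 = pt w z j\<close>] by blast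
  define \<tau> where "\<tau> j = Re (\<sigma> j)" for j
  have \<tau>: "\<tau> j = 1 \<or> \<tau> j = -1" "\<sigma> j = of_real (\<tau> j)" if "j \<in> {1..m}" for j
    using PiE_mem [OF \<sigma> that] by (auto simp: \<tau>_def)
  define T where "T = (\<Sum>j\<in>{1..m-1}. \<tau> j * sqrt (\<epsilon> j))"
  have "(\<Sum>j\<in>{1..m-1}. \<sigma> j * \<omega> j) = (\<Sum>j\<in>{1..m-1}. w * of_real (\<tau> j * sqrt (\<epsilon> j)))"
    using m \<tau>(2) by (intro sum.cong) (auto simp: \<omega>_def)
  also have "\<dots> = w * of_real T"
    by (simp add: T_def sum_distrib_left)
  finally have eq': "1 + (w * of_real T + of_real (\<tau> m) * v) = 0"
    using eq \<tau>(2) [of m] m unfolding sum_split by (simp add: \<omega>_def)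
  have v': "\<bar>Re v\<bar> = \<bar>1 + Re w * T\<bar>"
    using arg_cong [OF eq', of Re] \<tau>(1) [of m] m by auto
  show False
  proof (cases "\<forall>j\<in>{1..m-1}. \<tau> j = -1")
    case True
    then have "T = -s"
      by (simp add: T_def s_def sum_negf)
    then have "of_real s * w - 1 = of_real (\<tau> m) * v"
      using eq' by (simp add: algebra_simps add_eq_0_iff)
    moreover have "(of_real (\<tau> m))\<^sup>2 = (1::complex)"
      using \<tau>(1) [of m] m by auto
    ultimately show False
      using z v by (simp add: power_mult_distrib)
  next
    case False
    then obtain k where k: "k \<in> {1..m-1}" "\<tau> k = 1"
      using \<tau>(1) by fastforce
    \<comment> \<open>A single sign \<open>+1\<close> raises \<open>T\<close> above its minimum
      \<open>- s\<close> by twice \<open>sqrt (\<epsilon> k)\<close>, hence by more than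
      \<open>4 e\<close>. This is the term \<open>4 * e * Re w\<close> of the hypothesis.\<close>
    have "2 * (2 * e) \<le> (1 + \<tau> k) * sqrt (\<epsilon> k)"
      using two_e [OF k(1)] k(2) by simp
    also have "\<dots> \<le> (\<Sum>j\<in>{1..m-1}. (1 + \<tau> j) * sqrt (\<epsilon> j))"
    proof (rule member_le_sum [OF k(1)])
      fix j assume "j \<in> {1..m-1} - {k}"
      then have "j \<in> {1..m}"
        by auto
      then show "0 \<le> (1 + \<tau> j) * sqrt (\<epsilon> j)"
        using \<tau>(1) [of j] pos by (auto intro!: mult_nonneg_nonneg simp: less_imp_le)
    qed auto
    also have "\<dots> = s + T"
      by (simp add: s_def T_def distrib_right sum.distrib)
    finally have "Re w * (4 * e - s) \<le> Re w * T"
      using w by (intro mult_left_mono) auto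
    then have "1 - s * Re w + 4 * e * Re w \<le> 1 + Re w * T"
      by (simp add: algebra_simps)
    then show False
      using b v' by linarith
  qed
qed

lemma prod_pt: "w \<noteq> 0 \<Longrightarrow> (\<Prod>j\<in>{1..m-1}. pt w z j) \<noteq> 0"
  using pos by (force simp: pt_def)

lemma pt_Xtilde:
  assumes "w \<noteq> 0" "Rpoly m (pt w z) \<noteq> 0"
  shows "pt w z \<in> Xtilde m"
  using prod_pt [OF assms(1), of z] assms(2) m by (auto simp: Xtilde_def cspace_def pt_def)

lemma pt_Xspace:
  assumes "w \<noteq> 0" "Rpoly m (pt w z) \<noteq> 0" "z \<noteq> 0"
  shows "pt w z \<in> Xspace m"
proof -
  have "(\<Prod>j\<in>{1..m}. pt w z j) = (\<Prod>j\<in>{1..m-1}. pt w z j) * z"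
  proof -
    have "{1..m} = insert m {1..m-1}"
      using m by auto
    moreover have "pt w z m = z"
      using m by (auto simp: pt_def)
    ultimately show ?thesis
      using m by (simp add: mult.commute)
  qed
  then have "(\<Prod>j\<in>{1..m}. pt w z j) * Rpoly m (pt w z) \<noteq> 0"
    using prod_pt [OF assms(1), of z] assms(2,3) by simp
  moreover have "pt w z \<in> cspace m"
    using m by (auto simp: cspace_def pt_def)
  ultimately show ?thesis
    by (simp add: Xspace_def Sset_def)
qed

lemma Xspace_subset_Xtilde: "Xspace m \<subseteq> Xtilde m"
proof
  fix x assume x: "x \<in> Xspace m"
  have "{1..m} = insert m {1..m-1}"
    using m by auto
  then have "(\<Prod>j\<in>{1..m}. x j) = x m * (\<Prod>j\<in>{1..m-1}. x j)"
    using m by simp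
  with x show "x \<in> Xtilde m"
    by (auto simp: Xspace_def Sset_def Xtilde_def)
qed

text \<open>In the coordinate \<open>y = s w - 1\<close> the hypersurface is the parabola \<open>y\<^sup>2 = z\<close>, tangent to \<open>z = 0\<close>.\<close>

definition chart :: "complex \<Rightarrow> complex \<Rightarrow> nat \<Rightarrow> complex"
  where "chart y z = pt ((1 + y) / of_real s) z"

lemma s_pos: "0 < s" and s_half: "s < 1/2" and e_small: "6 * e < 1"
  using e_pos two_e_s s_e(2) by auto

lemma continuous_on_chart:
  assumes "continuous_on A f" "continuous_on A g"
  shows "continuous_on A (\<lambda>x. chart (f x) (g x))"
  unfolding chart_def using assms s_pos by (intro continuous_on_pt continuous_intros) auto

text \<open>The root of \<open>z\<close> has modulus at most \<open>e\<close>, and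
  \<open>1 - s Re w = - Re y\<close>. If \<open>Re y < - e\<close>, this alone exceeds
  \<open>e\<close>. Otherwise \<open>Re w \<ge> 1\<close>, and
  \<open>4 e - Re y \<ge> 2 e > e\<close>; hence the bound \<open>2 e\<close> on
  \<open>Re y\<close>.\<close>

lemma chart_Rpoly:
  assumes y: "-1 < Re y" "Re y \<le> 2 * e" and z: "cmod z \<le> e\<^sup>2" "y\<^sup>2 \<noteq> z"
  shows "(1 + y) / of_real s \<noteq> 0" "Rpoly m (chart y z) \<noteq> 0"
proof -
  let ?w = "(1 + y) / of_real s"
  have R: "Re ?w = (1 + Re y) / s"
    by (simp add: Re_divide_of_real)
  have w0: "0 < Re ?w"
    unfolding R using y s_pos by simp
  then show "?w \<noteq> 0" by force
  have sw: "of_real s * ?w = 1 + y" "s * Re ?w = 1 + Re y"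
    using s_pos unfolding R by auto
  have "\<bar>Re (csqrt z)\<bar> \<le> cmod (csqrt z)"
    by (rule abs_Re_le_cmod)
  also have "\<dots> \<le> e"
    using z(1) e_pos by (simp add: real_le_lsqrt)
  also have "e < 1 - s * Re ?w + 4 * e * Re ?w"
  proof (cases "Re y < -e")
    case True
    moreover have "0 < 4 * e * Re ?w"
      using e_pos w0 by (intro mult_pos_pos) auto
    ultimately show ?thesis
      unfolding sw(2) by linarith
  next
    case False
    have "s \<le> 1 + Re y"
      using False e_small s_half by linarith
    then have "1 \<le> Re ?w"
      unfolding R using s_pos by simp
    then have "4 * e * 1 \<le> 4 * e * Re ?w"
      using e_pos by (intro mult_left_mono) auto
    then show ?thesis
      unfolding sw(2) using y(2) e_pos by linarith
  qed
  finally show "Rpoly m (chart y z) \<noteq> 0"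
    unfolding chart_def by (intro Rpoly_pt [of "csqrt z"] w0) (use sw(1) z(2) in auto)
qed

lemma chart_Xtilde:
  assumes "-1 < Re y" "Re y \<le> 2 * e" "cmod z \<le> e\<^sup>2" "y\<^sup>2 \<noteq> z"
  shows "chart y z \<in> Xtilde m"
  using chart_Rpoly [OF assms] unfolding chart_def by (intro pt_Xtilde)

lemma chart_Xspace:
  assumes "-1 < Re y" "Re y \<le> 2 * e" "cmod z \<le> e\<^sup>2" "y\<^sup>2 \<noteq> z" "z \<noteq> 0"
  shows "chart y z \<in> Xspace m"
  using chart_Rpoly [OF assms(1-4)] assms(5) unfolding chart_def by (intro pt_Xspace)

section \<open>The base point and the given paths in chart coordinates (\<open>y = s - 1\<close>
  means \<open>w = 1\<close>)\<close>

lemma chart_base: "chart (of_real (s - 1)) z = (basept m \<epsilon>)(m := z)"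
proof
  fix j
  have "complex_of_real s \<noteq> 0"
    using s_pos by simp
  moreover have "j \<in> {1..m} \<longleftrightarrow> j \<in> {1..m-1} \<or> j = m"
    using m by auto
  moreover have "m \<notin> {1..m-1}"
    using m by auto
  ultimately show "chart (of_real (s - 1)) z j = ((basept m \<epsilon>)(m := z)) j"
    by (auto simp: chart_def pt_def basept_def)
qed

lemma chart_basept: "chart (of_real (s - 1)) (of_real (e\<^sup>2)) = basept m \<epsilon>"
  unfolding chart_base e_sq using m by (auto simp: basept_def fun_eq_iff)

lemma rho_chart: "rho m \<epsilon> t = chart (of_real (s - 1)) (of_real (e\<^sup>2) * exp (2 * of_real pi * \<i> * of_real t))"
  unfolding rho_def chart_base e_sq ..

lemma base_segment_chart: "base_segment m \<epsilon> t = chart (of_real (s - 1)) (of_real ((1 - t) * e\<^sup>2))"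
  unfolding base_segment_def chart_base e_sq ..

lemma fibre_Xspace:
  assumes "-1 < Re y" "Re y \<le> 2 * e" "y \<noteq> of_real e" "y \<noteq> - of_real e"
  shows "chart y (of_real (e\<^sup>2)) \<in> Xspace m"
proof (rule chart_Xspace [OF assms(1,2)])
  show "y\<^sup>2 \<noteq> of_real (e\<^sup>2)"
    using assms(3,4) by (simp add: power2_eq_iff)
qed (use e_pos in \<open>auto simp: norm_power\<close>)

section \<open>Half discs and the torus\<close>

definition circ :: "real \<Rightarrow> complex"
  where "circ \<phi> = of_real (2 * e) * exp (\<i> * of_real \<phi>)"

definition arc_path :: "real \<Rightarrow> real \<Rightarrow> real \<Rightarrow> complex"
  where "arc_path = part_circlepath 0 (2 * e)"

text \<open>Directed upwards, so that it closes the left half disc positively. Its upper end is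
  given the angle \<open>5 pi / 2\<close> rather than \<open>pi / 2\<close>, which makes the arcs of
  both half discs subdivide the interval from \<open>pi\<close> to \<open>3 pi\<close>.\<close>

definition diameter :: "real \<Rightarrow> complex"
  where "diameter = linepath (- (\<i> * of_real (2 * e))) (\<i> * of_real (2 * e))"

text \<open>The boundary of the left half of the disc of radius \<open>2 e\<close>. It contains \<open>- e\<close> but not \<open>e\<close>, the
  two points of the fibre \<open>z = e\<^sup>2\<close> to be avoided.\<close>

definition half_loop :: "real \<Rightarrow> complex"
  where "half_loop = arc_path pi (3 * pi / 2) +++ diameter +++ arc_path (5 * pi / 2) (3 * pi)"

definition fibre :: "complex \<Rightarrow> nat \<Rightarrow> complex"
  where "fibre y = chart y (of_real (e\<^sup>2))"

text \<open>The plane of the two angles, those of \<open>y\<close> and of \<open>z\<close>, covers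
  the torus; in this plane paths with the same ends are homotopic.\<close>

definition torus :: "real \<times> real \<Rightarrow> nat \<Rightarrow> complex"
  where "torus p = chart (circ (fst p)) (of_real (e\<^sup>2) * exp (\<i> * of_real (snd p)))"

lemma circ_cis: "circ \<phi> = of_real (2 * e) * cis \<phi>"
  by (simp add: circ_def cis_conv_exp)

lemma circ_simps:
  "circ pi = - of_real (2 * e)" "circ (3 * pi / 2) = - (\<i> * of_real (2 * e))" "circ (2 * pi) = of_real (2 * e)"
  "circ (5 * pi / 2) = \<i> * of_real (2 * e)" "circ (3 * pi) = - of_real (2 * e)"
proof -
  have "pi + pi / 2 = 3 * pi / 2" "2 * pi + pi / 2 = 5 * pi / 2" "2 * pi + pi = 3 * pi"
    by simp_all
  moreover have "cis (pi + pi / 2) = - \<i>" "cis (2 * pi + pi / 2) = \<i>" "cis (2 * pi + pi) = -1"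
    unfolding cis_mult [symmetric] cis_pi cis_2pi cis_pi_half by simp_all
  ultimately have "cis (3 * pi / 2) = - \<i>" "cis (5 * pi / 2) = \<i>" "cis (3 * pi) = -1"
    by metis+
  then show "circ pi = - of_real (2 * e)" "circ (3 * pi / 2) = - (\<i> * of_real (2 * e))" "circ (2 * pi) = of_real (2 * e)"
    "circ (5 * pi / 2) = \<i> * of_real (2 * e)" "circ (3 * pi) = - of_real (2 * e)"
    by (simp_all add: circ_cis)
qed

lemma circ_norm: "cmod (circ \<phi>) = 2 * e"
  using e_pos by (simp add: circ_def norm_mult)

lemma circ_Re: "Re (circ \<phi>) = 2 * e * cos \<phi>"
  by (simp add: circ_cis)

lemma circ_add_pi: "circ (\<phi> + pi) = - circ \<phi>"
  by (simp add: circ_cis flip: cis_mult)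

lemma circ_add_2pi: "circ (\<phi> + 2 * pi) = circ \<phi>"
  by (simp add: circ_cis flip: cis_mult)

lemma continuous_circ: "continuous_on A circ"
  unfolding circ_def by (intro continuous_intros)

lemma arc_path_circ: "arc_path a b = circ \<circ> linepath a b"
  by (simp add: arc_path_def part_circlepath_def circ_def fun_eq_iff)

lemma path_arc_path [simp]: "path (arc_path a b)"
  by (simp add: arc_path_def)

lemma arc_path_ends [simp]: "pathstart (arc_path a b) = circ a" "pathfinish (arc_path a b) = circ b"
  unfolding arc_path_circ by (simp_all add: pathstart_compose pathfinish_compose)

lemma linepath_translate: "linepath (a + c) (b + c) t = linepath a b t + c" for a b c :: "'b::real_normed_vector"
  by (simp add: linepath_def algebra_simps)

lemma arc_path_add_2pi: "arc_path (a + 2 * pi) (b + 2 * pi) = arc_path a b"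
  by (simp add: arc_path_circ fun_eq_iff linepath_translate circ_add_2pi)

lemma arc_path_add_pi: "uminus \<circ> arc_path a b = arc_path (a + pi) (b + pi)"
  by (simp add: arc_path_circ fun_eq_iff linepath_translate circ_add_pi)

lemma diameter_ends [simp]:
  "path diameter" "pathstart diameter = circ (3 * pi / 2)" "pathfinish diameter = circ (5 * pi / 2)"
  by (simp_all add: diameter_def circ_simps)

lemma diameter_image: "path_image diameter \<subseteq> {y. Re y = 0 \<and> cmod y \<le> 2 * e}"
proof -
  have *: "diameter t = \<i> * of_real ((2 * t - 1) * (2 * e))" for t
    by (simp add: diameter_def linepath_def scaleR_conv_of_real algebra_simps)
  have "Re (diameter t) = 0 \<and> cmod (diameter t) \<le> 2 * e" if "t \<in> {0..1}" for t
  proof -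
    have "\<bar>2 * t - 1\<bar> * (2 * e) \<le> 1 * (2 * e)"
      using that e_pos by (intro mult_right_mono) auto
    then show ?thesis
      unfolding * using e_pos by (simp add: norm_mult abs_mult del: of_real_mult)
  qed
  then show ?thesis
    by (auto simp: path_image_def)
qed

lemma arc_path_image_norm: "path_image (arc_path a b) \<subseteq> {y. cmod y = 2 * e}"
  by (auto simp: arc_path_circ path_image_def circ_norm)

lemma arc_path_image_Re:
  assumes "a \<le> b" "\<And>\<phi>. a \<le> \<phi> \<Longrightarrow> \<phi> \<le> b \<Longrightarrow> P (cos \<phi>)"
  shows "\<forall>y \<in> path_image (arc_path a b). \<exists>c. P c \<and> Re y = 2 * e * c"
proof
  fix y assume "y \<in> path_image (arc_path a b)"
  then obtain t where "y = circ (linepath a b t)" "t \<in> {0..1}"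
    by (auto simp: arc_path_circ path_image_def)
  moreover then have "linepath a b t \<in> {a..b}"
    using assms(1) linepath_in_path [of t a b] by (simp add: closed_segment_eq_real_ivl)
  ultimately show "\<exists>c. P c \<and> Re y = 2 * e * c"
    using assms(2) by (auto simp: circ_Re)
qed

lemma arc_path_left:
  "path_image (arc_path pi (3 * pi / 2)) \<subseteq> {y. Re y \<le> 0}"
  "path_image (arc_path (5 * pi / 2) (3 * pi)) \<subseteq> {y. Re y \<le> 0}"
proof -
  have 1: "cos \<phi> \<le> 0" if "pi \<le> \<phi>" "\<phi> \<le> 3 * pi / 2" for \<phi>
    using cos_ge_zero [of "\<phi> - pi"] that by (simp add: cos_diff)
  have 2: "cos \<phi> \<le> 0" if "5 * pi / 2 \<le> \<phi>" "\<phi> \<le> 3 * pi" for \<phi>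
    using 1 [of "\<phi> - pi"] cos_ge_zero [of "\<phi> - 3 * pi"] that by (simp add: cos_diff)
  show "path_image (arc_path pi (3 * pi / 2)) \<subseteq> {y. Re y \<le> 0}"
    "path_image (arc_path (5 * pi / 2) (3 * pi)) \<subseteq> {y. Re y \<le> 0}"
    using arc_path_image_Re [of pi "3 * pi / 2" "\<lambda>c. c \<le> 0"] 1
      arc_path_image_Re [of "5 * pi / 2" "3 * pi" "\<lambda>c. c \<le> 0"] 2 e_pos
    by (fastforce simp: mult_le_0_iff)+
qed

lemma arc_path_right:
  "path_image (arc_path (3 * pi / 2) (2 * pi)) \<subseteq> {y. 0 \<le> Re y}"
  "path_image (arc_path (2 * pi) (5 * pi / 2)) \<subseteq> {y. 0 \<le> Re y}"
proof -
  have 1: "0 \<le> cos \<phi>" if "3 * pi / 2 \<le> \<phi>" "\<phi> \<le> 5 * pi / 2" for \<phi>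
    using cos_ge_zero [of "\<phi> - 2 * pi"] that by (simp add: cos_diff)
  show "path_image (arc_path (3 * pi / 2) (2 * pi)) \<subseteq> {y. 0 \<le> Re y}"
    "path_image (arc_path (2 * pi) (5 * pi / 2)) \<subseteq> {y. 0 \<le> Re y}"
    using arc_path_image_Re [of "3 * pi / 2" "2 * pi" "\<lambda>c. 0 \<le> c"]
      arc_path_image_Re [of "2 * pi" "5 * pi / 2" "\<lambda>c. 0 \<le> c"] 1 e_pos
    by (fastforce simp: zero_le_mult_iff)+
qed

lemma half_loop_path [simp]:
  "path half_loop" "pathstart half_loop = - of_real (2 * e)" "pathfinish half_loop = - of_real (2 * e)"
  unfolding half_loop_def by (simp_all add: circ_simps)

lemma half_loop_image: "path_image half_loop \<subseteq> {y. Re y \<le> 0 \<and> cmod y \<le> 2 * e} - {- of_real e}"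
proof -
  have n: "y \<noteq> - of_real e" if "cmod y = 2 * e \<or> Re y = 0" for y
    using that e_pos by auto
  have "path_image half_loop \<subseteq> path_image (arc_path pi (3 * pi / 2)) \<union> (path_image diameter \<union> path_image (arc_path (5 * pi / 2) (3 * pi)))"
    unfolding half_loop_def by (meson Un_mono order_refl order_trans path_image_join_subset)
  also have "\<dots> \<subseteq> {y. Re y \<le> 0 \<and> cmod y \<le> 2 * e} - {- of_real e}"
  proof (intro Un_least subsetI)
    fix y
    show "y \<in> {y. Re y \<le> 0 \<and> cmod y \<le> 2 * e} - {- of_real e}" if "y \<in> path_image (arc_path pi (3 * pi / 2))"
      using that subsetD [OF arc_path_left(1) that] subsetD [OF arc_path_image_norm that] n by simp
    show "y \<in> {y. Re y \<le> 0 \<and> cmod y \<le> 2 * e} - {- of_real e}" if "y \<in> path_image diameter"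
      using that subsetD [OF diameter_image that] n by simp
    show "y \<in> {y. Re y \<le> 0 \<and> cmod y \<le> 2 * e} - {- of_real e}" if "y \<in> path_image (arc_path (5 * pi / 2) (3 * pi))"
      using that subsetD [OF arc_path_left(2) that] subsetD [OF arc_path_image_norm that] n by simp
  qed
  finally show ?thesis .
qed

text \<open>Both sides are images under \<open>circ\<close> of paths of angles from
  \<open>pi\<close> to \<open>3 pi\<close> on the real line.\<close>

lemma arc_path_join:
  "homotopic_paths {y. cmod y = 2 * e} (arc_path pi (3 * pi))
     (arc_path pi (3 * pi / 2) +++ arc_path (3 * pi / 2) (2 * pi) +++ arc_path (2 * pi) (5 * pi / 2) +++ arc_path (5 * pi / 2) (3 * pi))"
proof -
  let ?l = "linepath pi (3 * pi / 2) +++ linepath (3 * pi / 2) (2 * pi) +++ linepath (2 * pi) (5 * pi / 2) +++ linepath (5 * pi / 2) (3 * pi)"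
  have "homotopic_paths {y. cmod y = 2 * e} (circ \<circ> linepath pi (3 * pi)) (circ \<circ> ?l)"
    by (rule homotopic_paths_convex_image [of UNIV]) (auto simp: continuous_circ circ_norm)
  then show ?thesis
    unfolding path_compose_join arc_path_circ .
qed

text \<open>The full circle winds once around \<open>- e\<close>. It differs from
  \<open>half_loop\<close> by the boundary of the right half disc, which stays in
  \<open>Re y \<ge> 0\<close> and so does not wind around \<open>- e\<close>.\<close>

lemma winding_number_half_loop: "winding_number half_loop (- of_real e) = 1"
proof -
  let ?w = "- complex_of_real e"
  let ?B1 = "arc_path pi (3 * pi / 2)" and ?B2 = "arc_path (3 * pi / 2) (2 * pi)"
    and ?C1 = "arc_path (2 * pi) (5 * pi / 2)" and ?C2 = "arc_path (5 * pi / 2) (3 * pi)"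
  have a: "?w \<notin> path_image (arc_path a b)" for a b
    using arc_path_image_norm [of a b] e_pos by auto
  have d: "?w \<notin> path_image diameter"
    using diameter_image e_pos by auto
  have "homotopic_paths (-{?w}) (arc_path pi (3 * pi)) (?B1 +++ ?B2 +++ ?C1 +++ ?C2)"
    by (rule homotopic_paths_subset [OF arc_path_join]) (use e_pos in auto)
  then have "winding_number (arc_path pi (3 * pi)) ?w = winding_number (?B1 +++ ?B2 +++ ?C1 +++ ?C2) ?w"
    by (rule winding_number_homotopic_paths)
  moreover have "winding_number (arc_path pi (3 * pi)) ?w = 1"
    using e_pos unfolding arc_path_def by (intro winding_number_circle) auto
  ultimately have 1: "winding_number ?B1 ?w + winding_number ?B2 ?w + winding_number ?C1 ?w + winding_number ?C2 ?w = 1"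
    by (simp add: winding_number_join not_in_path_image_join a add.assoc)
  have "winding_number (reversepath diameter +++ ?B2 +++ ?C1) ?w = 0"
  proof (rule winding_number_zero_outside)
    show "convex {y. 0 \<le> Re y}"
      by (rule convex_halfspace_Re_ge)
    show "path_image (reversepath diameter +++ ?B2 +++ ?C1) \<subseteq> {y. 0 \<le> Re y}"
    proof -
      have "path_image diameter \<subseteq> {y. 0 \<le> Re y}"
        using diameter_image by auto
      then show ?thesis
        using arc_path_right by (simp add: subset_path_image_join)
    qed
  qed (use e_pos in auto)
  then have 2: "winding_number diameter ?w = winding_number ?B2 ?w + winding_number ?C1 ?w"
    by (simp add: winding_number_join winding_number_reversepath not_in_path_image_join a d)
  have "winding_number half_loop ?w = winding_number ?B1 ?w + (winding_number diameter ?w + winding_number ?C2 ?w)"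
    by (simp add: half_loop_def winding_number_join not_in_path_image_join a d)
  also have "\<dots> = 1"
    unfolding 2 using 1 by (simp only: add.assoc)
  finally show ?thesis .
qed

section \<open>Paths in the fibre \<open>z = e^2\<close> and on the torus\<close>

definition fibre_dom :: "complex set"
  where "fibre_dom = {y. -1 < Re y \<and> Re y \<le> 2 * e} - {of_real e, - of_real e}"

lemma continuous_fibre: "continuous_on A fibre"
  unfolding fibre_def by (intro continuous_on_chart continuous_intros)

lemma fibre_in: "fibre \<in> fibre_dom \<rightarrow> Xspace m"
  unfolding fibre_def fibre_dom_def by (auto intro!: fibre_Xspace simp del: of_real_power)

lemma fibre_path:
  assumes "path p" "path_image p \<subseteq> fibre_dom"
  shows "path (fibre \<circ> p)" "path_image (fibre \<circ> p) \<subseteq> Xspace m"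
  using assms fibre_in by (auto intro!: path_continuous_image continuous_fibre simp: path_image_compose)

lemma fibre_homotopic:
  assumes "homotopic_paths fibre_dom p q"
  shows "homotopic_paths (Xspace m) (fibre \<circ> p) (fibre \<circ> q)"
  using assms continuous_fibre fibre_in by (rule homotopic_paths_continuous_image)

lemma norm_le_2e: "cmod y \<le> 2 * e \<Longrightarrow> -1 < Re y \<and> Re y \<le> 2 * e"
  using abs_Re_le_cmod [of y] e_small by linarith

lemma arc_path_dom: "path_image (arc_path a b) \<subseteq> fibre_dom"
proof
  fix y assume "y \<in> path_image (arc_path a b)"
  then have "cmod y = 2 * e"
    using arc_path_image_norm by auto
  moreover then have "y \<noteq> of_real e" "y \<noteq> - of_real e"
    using e_pos by auto
  ultimately show "y \<in> fibre_dom"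
    using norm_le_2e [of y] by (simp add: fibre_dom_def)
qed

lemma diameter_dom: "path_image diameter \<subseteq> fibre_dom"
proof
  fix y assume "y \<in> path_image diameter"
  then have "cmod y \<le> 2 * e" "Re y = 0"
    using diameter_image by auto
  moreover then have "y \<noteq> of_real e" "y \<noteq> - of_real e"
    using e_pos by auto
  ultimately show "y \<in> fibre_dom"
    using norm_le_2e [of y] by (simp add: fibre_dom_def)
qed

lemma half_loop_dom: "path_image half_loop \<subseteq> fibre_dom"
proof
  fix y assume "y \<in> path_image half_loop"
  then have "cmod y \<le> 2 * e" "Re y \<le> 0" "y \<noteq> - of_real e"
    using half_loop_image by auto
  moreover then have "y \<noteq> of_real e"
    using e_pos by auto
  ultimately show "y \<in> fibre_dom"
    using norm_le_2e [of y] by (simp add: fibre_dom_def)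
qed

text \<open>On the torus \<open>y^2\<close> has modulus \<open>4 e^2\<close>, but \<open>z\<close>
  only \<open>e^2\<close>.\<close>

lemma torus_in: "torus p \<in> Xspace m"
proof -
  have n: "cmod ((circ (fst p))\<^sup>2) = 4 * e\<^sup>2" "cmod (of_real (e\<^sup>2) * exp (\<i> * of_real (snd p))) = e\<^sup>2"
    using circ_norm [of "fst p"] by (simp_all add: norm_power norm_mult)
  have "(circ (fst p))\<^sup>2 \<noteq> of_real (e\<^sup>2) * exp (\<i> * of_real (snd p))"
  proof
    assume "(circ (fst p))\<^sup>2 = of_real (e\<^sup>2) * exp (\<i> * of_real (snd p))"
    with n have "4 * e\<^sup>2 = e\<^sup>2"
      by simp
    then show False
      using e_pos by simp
  qed
  then show ?thesis
    unfolding torus_def using norm_le_2e [of "circ (fst p)"] circ_norm n e_pos by (intro chart_Xspace) auto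
qed

lemma continuous_torus: "continuous_on A torus"
  unfolding torus_def circ_def by (intro continuous_on_chart continuous_intros)

definition torus_line :: "real \<times> real \<Rightarrow> real \<times> real \<Rightarrow> real \<Rightarrow> nat \<Rightarrow> complex"
  where "torus_line a b = torus \<circ> linepath a b"

lemma torus_line_path:
  "path (torus_line a b)" "path_image (torus_line a b) \<subseteq> Xspace m"
  "pathstart (torus_line a b) = torus a" "pathfinish (torus_line a b) = torus b"
  by (auto simp: torus_line_def pathstart_compose pathfinish_compose path_image_compose torus_in
      intro!: path_continuous_image continuous_torus)

lemma torus_homotopic:
  assumes "path p" "path q" "pathstart p = pathstart q" "pathfinish p = pathfinish q"
  shows "homotopic_paths (Xspace m) (torus \<circ> p) (torus \<circ> q)"
  by (rule homotopic_paths_convex_image [of UNIV]) (use assms in \<open>auto simp: torus_in continuous_torus\<close>)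

lemma torus_line_fibre: "torus_line (a, 0) (b, 0) = fibre \<circ> arc_path a b"
  by (auto simp: fun_eq_iff torus_line_def torus_def fibre_def arc_path_circ linepath_def)

lemma torus_periodic: "torus (x + 2 * pi, y) = torus (x, y)" "torus (x, y + 2 * pi) = torus (x, y)"
proof -
  have "exp (\<i> * of_real (y + 2 * pi)) = exp (\<i> * complex_of_real y)"
    by (simp only: cis_conv_exp [symmetric] cis_mult [symmetric] cis_2pi mult_1_right)
  then show "torus (x + 2 * pi, y) = torus (x, y)" "torus (x, y + 2 * pi) = torus (x, y)"
    by (simp_all add: torus_def circ_add_2pi)
qed

lemma torus_line_periodic:
  "torus_line (a + 2 * pi, b) (c + 2 * pi, d) = torus_line (a, b) (c, d)"
  "torus_line (a, b + 2 * pi) (c, d + 2 * pi) = torus_line (a, b) (c, d)"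
proof -
  have *: "linepath (a, b) (c, d) t = (linepath a c t, linepath b d t)" for a b c d t :: real
    by (simp add: linepath_def)
  show "torus_line (a + 2 * pi, b) (c + 2 * pi, d) = torus_line (a, b) (c, d)"
    "torus_line (a, b + 2 * pi) (c, d + 2 * pi) = torus_line (a, b) (c, d)"
    by (simp_all add: fun_eq_iff torus_line_def * linepath_translate torus_periodic)
qed

lemma torus_base: "torus (pi, 0) = fibre (- of_real (2 * e))" "torus (3 * pi, 0) = fibre (- of_real (2 * e))"
  by (simp_all add: torus_def fibre_def circ_simps)

section \<open>The generators in the chart\<close>

definition approach :: "real \<Rightarrow> complex"
  where "approach = linepath (of_real (s - 1)) (- of_real (2 * e))"

lemma s_2e: "s - 1 < - (2 * e)"
  using two_e_s s_half by linarith

lemma approach_ends [simp]: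
  "path approach" "pathstart approach = of_real (s - 1)" "pathfinish approach = - of_real (2 * e)"
  by (simp_all add: approach_def)

lemma approach_image: "path_image approach = of_real ` {s - 1..- (2 * e)}"
  unfolding approach_def of_real_minus [symmetric] using s_2e by (intro real_linepath_image) simp

lemma approach_dom: "path_image approach \<subseteq> fibre_dom"
  unfolding approach_image fibre_dom_def using s_pos e_pos by (auto simp flip: of_real_minus)

lemma real_lasso_approach: "real_lasso (s - 1) 0 (2 * e) = approach +++ arc_path pi (3 * pi) +++ reversepath approach"
  by (simp add: real_lasso_def approach_def arc_path_def)

text \<open>On the line through the base point the root of the last coordinate is
  \<open>e u\<close>, so it moves with \<open>w = u\<close>.\<close>

lemma line_point_pt: "line_point m \<epsilon> (u\<^sup>2) = pt u ((of_real e * u)\<^sup>2)"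
proof
  fix j
  have "j \<in> {1..m} \<longleftrightarrow> j \<in> {1..m-1} \<or> j = m" "m \<notin> {1..m-1}"
    using m by auto
  moreover have "(of_real e * u)\<^sup>2 = u\<^sup>2 * complex_of_real (\<epsilon> m)"
    using e_sq by (simp add: power_mult_distrib flip: of_real_power)
  ultimately show "line_point m \<epsilon> (u\<^sup>2) j = pt u ((of_real e * u)\<^sup>2) j"
    by (auto simp: line_point_def basept_def pt_def)
qed

text \<open>With \<open>v = \<surd>z\<close> and \<open>p = y + v\<close>, the lasso around \<open>p = 0\<close> in the line through the base point is
  deformed into the fibre \<open>v = e\<close> by moving \<open>v\<close> linearly while keeping \<open>p\<close>.\<close>

lemma rho_last_to_fibre:
  assumes sr: "small_radius m \<epsilon> r"
  obtains \<rho> where "0 < \<rho>" "\<rho> \<le> e / 2"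
    "homotopic_paths (Xspace m) (rho_last m \<epsilon> r) (fibre \<circ> (\<lambda>t. real_lasso (s + e - 1) 0 \<rho> t - of_real e))"
proof -
  define S where "S = s + e"
  have S: "0 < S" "S < 1/2"
    using s_pos e_pos s_e(2) by (auto simp: S_def)
  define \<rho> where "\<rho> = min (e / 2) (r * S\<^sup>2 / 3)"
  have r: "0 < r"
    using sr by (simp add: small_radius_def)
  have \<rho>: "0 < \<rho>" "\<rho> \<le> e / 2" "\<rho> \<le> r * S\<^sup>2 / 3"
    using r S e_pos by (auto simp: \<rho>_def)
  have \<rho>S: "\<rho> \<le> S / 2"
    using \<rho> s_pos by (simp add: S_def)
  let ?L = "real_lasso (S - 1) 0 \<rho>"
  have L: "?L t \<noteq> 0" "S - 1 \<le> Re (?L t)" "Re (?L t) \<le> \<rho>" if "t \<in> {0..1}" for t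
    using real_lasso_box [of \<rho> "S - 1" 0 "?L t"] \<rho> \<rho>S S that by (auto simp: path_image_def)
  have "homotopic_paths (Xspace m) (rho_last m \<epsilon> r) ((\<lambda>p. line_point m \<epsilon> (((1 + p) / of_real S)\<^sup>2)) \<circ> ?L)"
    using rho_last_homotopic [of m \<epsilon> r \<rho>] m pos small sr \<rho> \<rho>S unfolding s_e(1) S_def by simp
  moreover
  \<comment> \<open>\<open>u\<close> is a square root of the line parameter; \<open>v\<close>
    interpolates between \<open>e u\<close>, the value on the line, and the constant
    \<open>e\<close>, the value on the fibre.\<close>
  define u where "u = (\<lambda>x::real \<times> real. (1 + ?L (snd x)) / of_real S)"
  define v where "v = (\<lambda>x::real \<times> real. of_real e * (u x * of_real (1 - fst x) + of_real (fst x)))"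
  \<comment> \<open>The solution of \<open>s w - 1 + v = p\<close>, written so that
    \<open>Re w \<ge> 1\<close> can be read off from \<open>Re u \<ge> 1\<close>.\<close>
  define w where "w = (\<lambda>x::real \<times> real. (of_real s * u x + of_real (fst x * e) * (u x - 1)) / of_real s)"
  define H where "H = (\<lambda>x. pt (w x) ((v x)\<^sup>2))"
  have "homotopic_paths (Xspace m) (\<lambda>t. H (0, t)) (\<lambda>t. H (1, t))"
  proof (rule homotopic_paths_fixed_ends)
    have "continuous_on ({0..1} \<times> {0..1}) (\<lambda>x. ?L (snd x))"
      using real_lasso_path(1) [of "S - 1" 0 \<rho>] unfolding path_def
      by (rule continuous_on_compose2) (auto intro!: continuous_intros)
    then have "continuous_on ({0..1} \<times> {0..1}) u"
      unfolding u_def using S by (intro continuous_intros) auto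
    then show "continuous_on ({0..1} \<times> {0..1}) H"
      unfolding H_def v_def w_def using s_pos by (intro continuous_on_pt continuous_intros) auto
    show "H \<in> {0..1} \<times> {0..1} \<rightarrow> Xspace m"
    proof
      fix x :: "real \<times> real" assume x: "x \<in> {0..1} \<times> {0..1}"
      then have t: "snd x \<in> {0..1}" and l: "0 \<le> fst x" "fst x \<le> 1"
        by auto
      define p where "p = ?L (snd x)"
      note p = L [OF t, folded p_def]
      have Su: "of_real S * u x = 1 + p"
        using S by (simp add: u_def p_def)
      have sw: "of_real s * w x = of_real s * u x + of_real (fst x * e) * (u x - 1)"
        using s_pos by (simp add: w_def)
      have "of_real s * w x - 1 = of_real S * u x - v x - 1"
        unfolding sw by (simp add: v_def S_def algebra_simps)
      then have sw': "of_real s * w x - 1 = p - v x"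
        unfolding Su by simp
      have "1 \<le> (1 + Re p) / S"
        using p(2) S by simp
      then have u1: "1 \<le> Re (u x)"
        by (simp add: u_def p_def Re_divide_of_real)
      have "1 - fst x \<le> Re (u x) * (1 - fst x)"
        using mult_right_mono [OF u1, of "1 - fst x"] l by simp
      then have "e * 1 \<le> e * (Re (u x) * (1 - fst x) + fst x)"
        using e_pos by (intro mult_left_mono) auto
      then have v1: "e \<le> Re (v x)"
        by (simp add: v_def)
      have sRew: "s * Re (w x) = s * Re (u x) + fst x * e * (Re (u x) - 1)"
        using arg_cong [OF sw, of Re] by simp
      have "s * 1 \<le> s * Re (u x)" "0 \<le> fst x * e * (Re (u x) - 1)"
        using s_pos u1 l e_pos by (auto intro!: mult_left_mono mult_nonneg_nonneg)
      then have "s * 1 \<le> s * Re (w x)"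
        unfolding sRew by linarith
      then have w1: "1 \<le> Re (w x)"
        using s_pos by simp
      have "s * Re (w x) = 1 + Re p - Re (v x)"
        using arg_cong [OF sw', of Re] by simp
      moreover have "4 * e * 1 \<le> 4 * e * Re (w x)"
        using w1 e_pos by (intro mult_left_mono) auto
      ultimately have b: "\<bar>Re (v x)\<bar> < 1 - s * Re (w x) + 4 * e * Re (w x)"
        using v1 p(3) \<rho>(2) e_pos by linarith
      \<comment> \<open>The parabola \<open>(p - v)^2 = v^2\<close> consists of \<open>p = 0\<close>
        and \<open>p = 2 v\<close>; the second is excluded by \<open>Re p \<le> e / 2\<close> and
        \<open>Re v \<ge> e\<close>.\<close>
      have "p \<noteq> 2 * v x"
        using p(3) v1 \<rho>(2) e_pos by (auto simp: complex_eq_iff)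
      then have ne: "(of_real s * w x - 1)\<^sup>2 \<noteq> (v x)\<^sup>2"
        unfolding sw' power2_eq_iff using p(1) by (auto simp: algebra_simps)
      have "w x \<noteq> 0" "v x \<noteq> 0"
        using w1 v1 e_pos by auto
      then show "H x \<in> Xspace m"
        unfolding H_def using Rpoly_pt [OF refl ne _ b] w1 by (intro pt_Xspace) auto
    qed
    have base: "u (l, t) = 1 \<Longrightarrow> H (l, t) = basept m \<epsilon>" for l t
    proof -
      assume u1: "u (l, t) = 1"
      have "w (l, t) = 1" "v (l, t) = of_real e"
        using u1 s_pos by (simp_all add: w_def v_def)
      then show "H (l, t) = basept m \<epsilon>"
        using line_point_pt [of 1] by (simp add: H_def line_point_def)
    qed
    have "u (l, 0) = 1" "u (l, 1) = 1" for l
      using real_lasso_path(2,3) [of "S - 1" 0 \<rho>] S by (simp_all add: u_def pathstart_def pathfinish_def)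
    then show "H (l, 0) = basept m \<epsilon>" "H (l, 1) = basept m \<epsilon>" for l
      using base by blast+
  qed
  moreover have "(\<lambda>t. H (0, t)) = (\<lambda>p. line_point m \<epsilon> (((1 + p) / of_real S)\<^sup>2)) \<circ> ?L"
    unfolding comp_def line_point_pt using s_pos by (simp add: H_def w_def v_def u_def)
  moreover have "(\<lambda>t. H (1, t)) = fibre \<circ> (\<lambda>t. ?L t - of_real e)"
  proof
    fix t
    have "of_real S * u (1, t) = 1 + ?L t"
      using S by (simp add: u_def)
    then have "of_real s * u (1, t) + of_real e * (u (1, t) - 1) = 1 + (?L t - of_real e)"
      by (simp add: S_def algebra_simps)
    then show "H (1, t) = (fibre \<circ> (\<lambda>t. ?L t - of_real e)) t"
      by (simp add: H_def w_def v_def fibre_def chart_def)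
  qed
  ultimately have "homotopic_paths (Xspace m) (rho_last m \<epsilon> r) (fibre \<circ> (\<lambda>t. ?L t - of_real e))"
    using homotopic_paths_trans by metis
  with \<rho>(1,2) show thesis
    unfolding S_def by (rule that)
qed

text \<open>In the fibre, the small lasso and the half disc joined to the base point both wind once
  around \<open>- e\<close>.\<close>

lemma rho_last_half_loop:
  assumes sr: "small_radius m \<epsilon> r"
  shows "homotopic_paths (Xspace m) (rho_last m \<epsilon> r)
    ((fibre \<circ> approach) +++ (fibre \<circ> half_loop) +++ reversepath (fibre \<circ> approach))"
proof -
  obtain \<rho> where \<rho>: "0 < \<rho>" "\<rho> \<le> e / 2" and
    h: "homotopic_paths (Xspace m) (rho_last m \<epsilon> r) (fibre \<circ> (\<lambda>t. real_lasso (s + e - 1) 0 \<rho> t - of_real e))"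
    using rho_last_to_fibre [OF sr] by blast
  let ?L = "real_lasso (s + e - 1) 0 \<rho>" and ?w = "- complex_of_real e"
  let ?M = "\<lambda>t. ?L t - of_real e" and ?N = "approach +++ half_loop +++ reversepath approach"
  \<comment> \<open>The right edge \<open>0\<close> excludes the puncture \<open>e\<close>, so that
    the winding number around \<open>- e\<close> decides.\<close>
  define A where "A = strip (s - 1) 0 (2 * e)"
  have le: "s + e - 1 \<le> 0 - \<rho>"
    using \<rho> s_e(2) e_small by linarith
  have M: "path ?M"
    using real_lasso_path(1) [of "s + e - 1" 0 \<rho>] unfolding path_def by (intro continuous_intros)
  have wa: "?w \<notin> path_image approach"
    unfolding approach_image using e_pos by (auto simp flip: of_real_minus)
  have wh: "?w \<notin> path_image half_loop"
    using half_loop_image by blast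
  have "homotopic_paths (A - {?w}) ?M ?N"
  proof (rule homotopic_paths_punctured_convex)
    show "convex A" "closed A"
      by (simp_all add: A_def strip_convex strip_closed)
    show "?w \<in> interior A"
      using e_pos s_2e by (simp add: A_def strip_interior)
    show "path ?M" by (rule M)
    show "path_image ?M \<subseteq> A - {?w}"
    proof -
      have "?M t \<in> A - {?w}" if "t \<in> {0..1}" for t
        using real_lasso_box [OF \<rho>(1) le, of "?L t"] that \<rho> by (auto simp: A_def mem_strip path_image_def)
      then show ?thesis
        by (auto simp: path_image_def)
    qed
    show "path ?N" by simp
    have "path_image half_loop \<subseteq> A - {?w}"
    proof
      fix y assume "y \<in> path_image half_loop"
      then have "Re y \<le> 0" "cmod y \<le> 2 * e" "y \<noteq> ?w"
        using half_loop_image by auto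
      then show "y \<in> A - {?w}"
        using abs_Re_le_cmod [of y] abs_Im_le_cmod [of y] s_2e by (simp add: A_def mem_strip)
    qed
    moreover have "path_image approach \<subseteq> A - {?w}"
      using wa e_pos unfolding approach_image A_def by (auto simp: mem_strip)
    ultimately show "path_image ?N \<subseteq> A - {?w}"
      by (simp add: subset_path_image_join)
    show "pathstart ?N = pathstart ?M" "pathfinish ?N = pathfinish ?M"
      using real_lasso_path(2,3) [of "s + e - 1" 0 \<rho>, unfolded pathstart_def pathfinish_def]
      by (simp_all add: pathstart_def [of ?M] pathfinish_def [of ?M])
    have "winding_number ?M ?w = winding_number (\<lambda>t. ?M t - ?w) 0"
      by (rule winding_number_offset)
    also have "\<dots> = winding_number ?L (of_real 0)"
      by simp
    also have "\<dots> = 1"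
      by (rule winding_number_real_lasso [OF \<rho>(1) le])
    also have "1 = winding_number ?N ?w"
      using wa wh by (simp add: winding_number_join winding_number_reversepath not_in_path_image_join winding_number_half_loop)
    finally show "winding_number ?M ?w = winding_number ?N ?w" .
  qed
  moreover have "A - {?w} \<subseteq> fibre_dom"
    using s_pos e_pos by (auto simp: A_def mem_strip fibre_dom_def)
  ultimately have "homotopic_paths (Xspace m) (fibre \<circ> ?M) (fibre \<circ> ?N)"
    by (blast intro: fibre_homotopic homotopic_paths_subset)
  with h show ?thesis
    unfolding path_compose_join path_compose_reversepath by (rule homotopic_paths_trans)
qed

section \<open>Transport along the approach, by the half turn and over the torus\<close>

lemma outer:
  assumes "2 * e \<le> cmod y" "cmod z \<le> e\<^sup>2"
  shows "y\<^sup>2 \<noteq> z"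
proof
  assume "y\<^sup>2 = z"
  then have "(cmod y)\<^sup>2 \<le> e\<^sup>2"
    using assms(2) by (auto simp: norm_power)
  moreover have "(2 * e)\<^sup>2 \<le> (cmod y)\<^sup>2"
    using assms(1) e_pos by (intro power_mono) auto
  moreover have "(2 * e)\<^sup>2 = 4 * e\<^sup>2" "0 < e\<^sup>2"
    using e_pos by (simp_all add: power_mult_distrib)
  ultimately show False
    by linarith
qed

lemma approach_outer:
  assumes "t \<in> {0..1}"
  shows "2 * e \<le> cmod (approach t)" "-1 < Re (approach t)" "Re (approach t) \<le> 2 * e"
proof -
  have "approach t \<in> of_real ` {s - 1..- (2 * e)}"
    using assms approach_image by (auto simp: path_image_def)
  then show "2 * e \<le> cmod (approach t)" "-1 < Re (approach t)" "Re (approach t) \<le> 2 * e"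
    using s_pos e_pos by auto
qed

lemma continuous_approach: "continuous_on A approach"
  unfolding approach_def by (intro continuous_intros)

text \<open>While \<open>z\<close> turns, \<open>y\<close> may run along the whole segment, because
  its modulus never falls below \<open>2 e\<close>.\<close>

lemma rho_approach:
  "homotopic_paths (Xspace m) (rho m \<epsilon> +++ (fibre \<circ> approach)) ((fibre \<circ> approach) +++ torus_line (pi, 0) (pi, 2 * pi))"
proof -
  define H where "H x = chart (approach (snd x)) (of_real (e\<^sup>2) * exp (2 * of_real pi * \<i> * of_real (fst x)))"
    for x :: "real \<times> real"
  have sq: "homotopic_paths (Xspace m) ((\<lambda>x. H (x, 0)) +++ (\<lambda>t. H (1, t))) ((\<lambda>t. H (0, t)) +++ (\<lambda>x. H (x, 1)))"
  proof (rule homotopic_paths_square)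
    show "continuous_on ({0..1} \<times> {0..1}) H"
      unfolding H_def
      by (intro continuous_on_chart continuous_on_compose2 [OF continuous_approach [of UNIV]] continuous_intros) auto
    show "H \<in> {0..1} \<times> {0..1} \<rightarrow> Xspace m"
    proof
      fix x :: "real \<times> real" assume "x \<in> {0..1} \<times> {0..1}"
      then have "snd x \<in> {0..1}" by auto
      note a = approach_outer [OF this]
      have z: "cmod (of_real (e\<^sup>2) * exp (2 * of_real pi * \<i> * of_real (fst x))) \<le> e\<^sup>2"
        by (simp add: norm_mult norm_power)
      show "H x \<in> Xspace m"
        unfolding H_def using a e_pos by (intro chart_Xspace z outer) auto
    qed
  qed
  have "approach 0 = of_real (s - 1)" "approach 1 = - of_real (2 * e)"
    using approach_ends(2,3) unfolding pathstart_def pathfinish_def .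
  moreover have "linepath (pi, 0) (pi, 2 * pi) x = (pi, 2 * pi * x)" for x
    by (simp add: linepath_def algebra_simps)
  ultimately have "(\<lambda>x. H (x, 0)) = rho m \<epsilon>" "(\<lambda>x. H (x, 1)) = torus_line (pi, 0) (pi, 2 * pi)"
    by (simp_all add: fun_eq_iff H_def rho_chart torus_line_def torus_def circ_simps mult_ac)
  moreover have "exp (2 * complex_of_real pi * \<i>) = 1"
    by (rule exp_two_pi_i)
  then have "(\<lambda>t. H (1, t)) = fibre \<circ> approach" "(\<lambda>t. H (0, t)) = fibre \<circ> approach"
    by (simp_all add: fun_eq_iff H_def fibre_def)
  ultimately show ?thesis
    using sq by simp
qed

text \<open>The rotation \<open>(y, z) \<mapsto> (c y, c\<^sup>2 z)\<close> preserves the parabola. The half turn \<open>c = exp (- \<i> \<pi> t)\<close>,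
  \<open>0 \<le> t \<le> 1\<close>, moves the left half disc to the right one while \<open>z\<close> goes once around \<open>0\<close>.\<close>

lemma half_loop_rotation:
  "homotopic_paths (Xspace m) ((fibre \<circ> half_loop) +++ torus_line (3 * pi, 0) (2 * pi, - 2 * pi))
     (torus_line (3 * pi, 0) (2 * pi, - 2 * pi) +++ (fibre \<circ> (uminus \<circ> half_loop)))"
proof -
  define c where "c t = exp (\<i> * of_real (- (pi * t)))" for t :: real
  define H where "H x = chart (half_loop (fst x) * c (snd x)) (of_real (e\<^sup>2) * (c (snd x))\<^sup>2)" for x :: "real \<times> real"
  have c: "cmod (c t) = 1" for t
    by (simp add: c_def del: of_real_minus of_real_mult)
  have "homotopic_paths (Xspace m) ((\<lambda>x. H (x, 0)) +++ (\<lambda>t. H (1, t))) ((\<lambda>t. H (0, t)) +++ (\<lambda>x. H (x, 1)))"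
  proof (rule homotopic_paths_square)
    have "continuous_on ({0..1} \<times> {0..1}) (\<lambda>x::real\<times>real. half_loop (fst x))"
      using half_loop_path(1) unfolding path_def
      by (rule continuous_on_compose2) (auto intro!: continuous_intros)
    then show "continuous_on ({0..1} \<times> {0..1}) H"
      unfolding H_def c_def by (intro continuous_on_chart continuous_intros)
    show "H \<in> {0..1} \<times> {0..1} \<rightarrow> Xspace m"
    proof
      fix x :: "real \<times> real" assume "x \<in> {0..1} \<times> {0..1}"
      then have h: "half_loop (fst x) \<in> path_image half_loop"
        by (auto simp: path_image_def)
      then have "cmod (half_loop (fst x) * c (snd x)) \<le> 2 * e"
        using half_loop_image by (auto simp: norm_mult c)
      note norm_le_2e [OF this]
      moreover have "(half_loop (fst x))\<^sup>2 \<noteq> (of_real e)\<^sup>2"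
        using h half_loop_dom unfolding fibre_dom_def power2_eq_iff by blast
      moreover have "c (snd x) \<noteq> 0"
        using c [of "snd x"] by force
      ultimately show "H x \<in> Xspace m"
        unfolding H_def using e_pos
        by (intro chart_Xspace) (auto simp: norm_mult norm_power c power_mult_distrib)
    qed
  qed
  moreover have "half_loop 0 = circ (3 * pi)" "half_loop 1 = circ (3 * pi)"
    using half_loop_path(2,3) unfolding pathstart_def pathfinish_def circ_simps .
  \<comment> \<open>The trace of the base point \<open>- 2 e\<close>: the angle of \<open>y\<close>
    decreases by \<open>pi\<close>, that of \<open>z\<close> by \<open>2 pi\<close>. Starting at
    \<open>3 pi\<close> makes it end at \<open>2 pi\<close>, the joint of the two right-hand
    arcs.\<close>
  moreover have "torus_line (3 * pi, 0) (2 * pi, - 2 * pi) t = chart (circ (3 * pi) * c t) (of_real (e\<^sup>2) * (c t)\<^sup>2)" for t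
  proof -
    have "linepath (3 * pi, 0) (2 * pi, - 2 * pi) t = (3 * pi + - (pi * t), - (pi * t) + - (pi * t))"
      by (simp add: linepath_def algebra_simps)
    moreover have "circ (3 * pi + - (pi * t)) = circ (3 * pi) * c t"
      unfolding circ_def c_def by (simp only: of_real_add distrib_left exp_add mult.assoc)
    moreover have "exp (\<i> * of_real (- (pi * t) + - (pi * t))) = (c t)\<^sup>2"
      unfolding c_def by (simp only: of_real_add distrib_left exp_add power2_eq_square)
    ultimately show ?thesis
      by (simp add: torus_line_def torus_def)
  qed
  then have "torus_line (3 * pi, 0) (2 * pi, - 2 * pi) = (\<lambda>t. chart (circ (3 * pi) * c t) (of_real (e\<^sup>2) * (c t)\<^sup>2))"
    by (rule ext)
  ultimately have "homotopic_paths (Xspace m) ((\<lambda>x. H (x, 0)) +++ torus_line (3 * pi, 0) (2 * pi, - 2 * pi))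
     (torus_line (3 * pi, 0) (2 * pi, - 2 * pi) +++ (\<lambda>x. H (x, 1)))"
    by (simp only: H_def fst_conv snd_conv)
  moreover have "c 0 = 1" "c 1 = -1"
    by (simp_all add: c_def exp_minus mult.commute [of \<i>])
  then have "(\<lambda>x. H (x, 0)) = fibre \<circ> half_loop" "(\<lambda>x. H (x, 1)) = fibre \<circ> (uminus \<circ> half_loop)"
    by (simp_all add: fun_eq_iff H_def fibre_def)
  ultimately show ?thesis by simp
qed

text \<open>Negation adds \<open>pi\<close> to every angle and reverses the diameter; the last arc
  then has to be brought back by a full turn.\<close>

lemma uminus_half_loop:
  "uminus \<circ> half_loop = arc_path (2 * pi) (5 * pi / 2) +++ reversepath diameter +++ arc_path (3 * pi / 2) (2 * pi)"
proof -
  have "uminus \<circ> arc_path pi (3 * pi / 2) = arc_path (2 * pi) (5 * pi / 2)"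
    unfolding arc_path_add_pi by (rule arg_cong2 [where f = arc_path]) simp_all
  moreover have "uminus \<circ> arc_path (5 * pi / 2) (3 * pi) = arc_path (3 * pi / 2) (2 * pi)"
  proof -
    have "arc_path (5 * pi / 2 + pi) (3 * pi + pi) = arc_path (3 * pi / 2 + 2 * pi) (2 * pi + 2 * pi)"
      by (rule arg_cong2 [where f = arc_path]) simp_all
    then show ?thesis
      unfolding arc_path_add_pi arc_path_add_2pi .
  qed
  moreover have "uminus \<circ> diameter = reversepath diameter"
    by (auto simp: diameter_def reversepath_def linepath_def fun_eq_iff algebra_simps)
  ultimately show ?thesis
    unfolding half_loop_def path_compose_join by simp
qed

text \<open>In the plane of angles the diagonal is replaced by a vertical and two horizontal
  segments. Periodicity identifies the vertical one with the reversed turn of \<open>z\<close> at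
  \<open>y = - 2 e\<close> and moves the horizontal ones to \<open>z = e^2\<close>.\<close>

lemma rotation_path:
  "homotopic_paths (Xspace m) (torus_line (3 * pi, 0) (2 * pi, - 2 * pi))
     (reversepath (torus_line (pi, 0) (pi, 2 * pi)) +++ reversepath (fibre \<circ> arc_path (5 * pi / 2) (3 * pi)) +++
       reversepath (fibre \<circ> arc_path (2 * pi) (5 * pi / 2)))"
proof -
  have r: "reversepath (torus_line a b) = torus_line b a" for a b
    by (simp add: torus_line_def flip: path_compose_reversepath)
  have "torus_line (pi, 2 * pi) (pi, 0) = torus_line (pi + 2 * pi, - 2 * pi + 2 * pi + 2 * pi) (pi + 2 * pi, - 2 * pi + 2 * pi)"
    unfolding torus_line_periodic(1) by simp
  also have "\<dots> = torus_line (3 * pi, 0) (3 * pi, - 2 * pi)"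
    unfolding torus_line_periodic(2) by simp
  finally have 1: "torus_line (pi, 2 * pi) (pi, 0) = torus_line (3 * pi, 0) (3 * pi, - 2 * pi)" .
  have 2: "torus_line (a, 0) (b, 0) = torus_line (a, - 2 * pi) (b, - 2 * pi)" for a b
    using torus_line_periodic(2) [of a "- 2 * pi" b "- 2 * pi"] by simp
  have "homotopic_paths (Xspace m) (torus \<circ> linepath (3 * pi, 0) (2 * pi, - 2 * pi))
    (torus \<circ> (linepath (3 * pi, 0) (3 * pi, - 2 * pi) +++ linepath (3 * pi, - 2 * pi) (5 * pi / 2, - 2 * pi) +++
        linepath (5 * pi / 2, - 2 * pi) (2 * pi, - 2 * pi)))"
    by (rule torus_homotopic) auto
  then show ?thesis
    unfolding torus_line_fibre [symmetric] r 1 2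
    unfolding torus_line_def path_compose_join .
qed

lemma circle_split:
  "homotopic_paths (Xspace m) (fibre \<circ> arc_path pi (3 * pi))
     ((fibre \<circ> arc_path pi (3 * pi / 2)) +++ (fibre \<circ> arc_path (3 * pi / 2) (2 * pi)) +++
      (fibre \<circ> arc_path (2 * pi) (5 * pi / 2)) +++ (fibre \<circ> arc_path (5 * pi / 2) (3 * pi)))"
proof -
  have "{y. cmod y = 2 * e} \<subseteq> fibre_dom"
  proof
    fix y assume "y \<in> {y. cmod y = 2 * e}"
    moreover then have "y \<noteq> of_real e" "y \<noteq> - of_real e"
      using e_pos by auto
    ultimately show "y \<in> fibre_dom"
      using norm_le_2e [of y] by (simp add: fibre_dom_def)
  qed
  then show ?thesis
    using fibre_homotopic [OF homotopic_paths_subset [OF arc_path_join]] unfolding path_compose_join by blast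
qed

text \<open>The commutator of a torus: two routes along the boundary of a full period rectangle of
  angles, whose opposite sides have the same image.\<close>

lemma circle_meridian_commute:
  "homotopic_paths (Xspace m) (torus_line (pi, 0) (pi, 2 * pi) +++ (fibre \<circ> arc_path pi (3 * pi)))
     ((fibre \<circ> arc_path pi (3 * pi)) +++ torus_line (pi, 0) (pi, 2 * pi))"
proof -
  have 1: "fibre \<circ> arc_path pi (3 * pi) = torus_line (pi, 2 * pi) (3 * pi, 2 * pi)"
    using torus_line_periodic(2) [of pi 0 "3 * pi" 0] by (simp add: torus_line_fibre)
  have 2: "torus_line (pi, 0) (pi, 2 * pi) = torus_line (3 * pi, 0) (3 * pi, 2 * pi)"
    using torus_line_periodic(1) [of pi 0 pi "2 * pi"] by simp
  have "homotopic_paths (Xspace m) (torus \<circ> (linepath (pi, 0) (pi, 2 * pi) +++ linepath (pi, 2 * pi) (3 * pi, 2 * pi)))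
     (torus \<circ> (linepath (pi, 0) (3 * pi, 0) +++ linepath (3 * pi, 0) (3 * pi, 2 * pi)))"
    by (rule torus_homotopic) auto
  then show ?thesis
    unfolding path_compose_join torus_line_def [symmetric] torus_line_fibre
    unfolding 1 [symmetric] 2 [symmetric] .
qed

section \<open>The relation in the fundamental group\<close>

text \<open>Written as a lasso, it can be compared by winding number with the last generator for
  \<open>m - 1\<close> variables; split by \<open>big_loop_split\<close>, it enters the group
  computation.\<close>

definition big_loop :: "real \<Rightarrow> nat \<Rightarrow> complex"
  where "big_loop = fibre \<circ> real_lasso (s - 1) 0 (2 * e)"

lemma fibre_base: "fibre (of_real (s - 1)) = basept m \<epsilon>"
  unfolding fibre_def by (rule chart_basept)

lemma rho_loop: "rho m \<epsilon> \<in> loops_at (Xspace m) (basept m \<epsilon>)"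
proof -
  let ?h = "\<lambda>t. chart (of_real (s - 1)) (of_real (e\<^sup>2) * exp (2 * of_real pi * \<i> * of_real t))"
  have h: "rho m \<epsilon> = ?h"
    by (rule ext) (rule rho_chart)
  have n: "2 * e \<le> cmod (of_real (s - 1))" "cmod (of_real (e\<^sup>2) * exp (2 * of_real pi * \<i> * of_real t)) \<le> e\<^sup>2" for t
    using s_2e e_pos by (auto simp: norm_mult norm_power simp del: of_real_diff)
  have "?h t \<in> Xspace m" for t
    using s_pos s_half e_pos by (intro chart_Xspace n outer [OF n]) auto
  moreover have "path ?h"
    unfolding path_def by (intro continuous_on_chart continuous_intros)
  ultimately have "path (rho m \<epsilon>)" "path_image (rho m \<epsilon>) \<subseteq> Xspace m"
    unfolding h by (auto simp: path_image_def)
  moreover have "exp (2 * complex_of_real pi * \<i>) = 1"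
    by (rule exp_two_pi_i)
  then have "pathstart (rho m \<epsilon>) = basept m \<epsilon>" "pathfinish (rho m \<epsilon>) = basept m \<epsilon>"
    using chart_basept by (simp_all add: pathstart_def pathfinish_def rho_chart)
  ultimately show ?thesis
    by (simp add: loops_at_def)
qed

lemma rho_last_loop_m: "small_radius m \<epsilon> r \<Longrightarrow> rho_last m \<epsilon> r \<in> loops_at (Xspace m) (basept m \<epsilon>)"
  using rho_last_loop [of m \<epsilon> r] m pos small by simp

lemma big_loop_split:
  "big_loop = (fibre \<circ> approach) +++ (fibre \<circ> arc_path pi (3 * pi)) +++ reversepath (fibre \<circ> approach)"
  unfolding big_loop_def real_lasso_approach path_compose_join path_compose_reversepath ..

lemma big_loop_loop: "big_loop \<in> loops_at (Xspace m) (basept m \<epsilon>)"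
  using fibre_path [OF approach_ends(1) approach_dom] fibre_path [OF path_arc_path arc_path_dom, of pi "3 * pi"]
  unfolding big_loop_split loops_at_def
  by (simp add: pathstart_compose pathfinish_compose circ_simps subset_path_image_join fibre_base [unfolded of_real_diff of_real_1])

text \<open>All three classes are conjugates, by the holonomy of the approach path \<open>g\<close>,
  of loops based at \<open>y = - 2 e\<close>: the turn \<open>A\<close> of \<open>z\<close>, the
  half disc \<open>h\<close> and the circle \<open>K\<close>. There the half turn and the torus give
  both relations.\<close>

lemma fundamental_relations:
  assumes sr: "small_radius m \<epsilon> r"
  defines "G \<equiv> fundamental_group (Xspace m) (basept m \<epsilon>)"
    and "a \<equiv> path_class (Xspace m) (rho m \<epsilon>)" and "b \<equiv> path_class (Xspace m) (rho_last m \<epsilon> r)"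
    and "c \<equiv> path_class (Xspace m) big_loop"
  shows "b \<otimes>\<^bsub>G\<^esub> (a \<otimes>\<^bsub>G\<^esub> (b \<otimes>\<^bsub>G\<^esub> inv\<^bsub>G\<^esub> a)) = c" "c \<otimes>\<^bsub>G\<^esub> a = a \<otimes>\<^bsub>G\<^esub> c"
proof -
  let ?X = "Xspace m" and ?x = "basept m \<epsilon>"
  let ?hol = "holonomy ?X ?x" and ?at = "path_at ?X ?x"
  have "?x \<in> ?X"
    using rho_loop pathstart_in_path_image [of "rho m \<epsilon>"] by (auto simp: loops_at_def)
  then interpret group G
    unfolding G_def by (rule fundamental_group_group)
  define g where "g = fibre \<circ> approach"
  define A where "A = torus_line (pi, 0) (pi, 2 * pi)"
  define B1 where "B1 = fibre \<circ> arc_path pi (3 * pi / 2)"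
  define B2 where "B2 = fibre \<circ> arc_path (3 * pi / 2) (2 * pi)"
  define C1 where "C1 = fibre \<circ> arc_path (2 * pi) (5 * pi / 2)"
  define C2 where "C2 = fibre \<circ> arc_path (5 * pi / 2) (3 * pi)"
  define D where "D = fibre \<circ> diameter"
  define K where "K = fibre \<circ> arc_path pi (3 * pi)"
  define h where "h = fibre \<circ> half_loop"
  define h' where "h' = fibre \<circ> (uminus \<circ> half_loop)"
  define q where "q = torus_line (3 * pi, 0) (2 * pi, - 2 * pi)"
  let ?F = "\<lambda>\<phi>. fibre (circ \<phi>)"
  have F3: "?F (3 * pi) = ?F pi"
    by (simp add: circ_simps)
  have h_eq: "h = B1 +++ D +++ C2"
    unfolding h_def half_loop_def path_compose_join B1_def D_def C2_def ..
  have h'_eq: "h' = C1 +++ reversepath D +++ B2"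
    unfolding h'_def uminus_half_loop path_compose_join path_compose_reversepath B2_def D_def C1_def ..
  have big: "big_loop = g +++ K +++ reversepath g"
    unfolding big_loop_split g_def K_def ..
  have rho_ends: "pathstart (rho m \<epsilon>) = ?x" "pathfinish (rho m \<epsilon>) = ?x"
    "pathstart (rho_last m \<epsilon> r) = ?x" "pathfinish (rho_last m \<epsilon> r) = ?x"
    using rho_loop rho_last_loop_m [OF sr] by (auto simp: loops_at_def)
  have ends: "pathstart g = ?x" "pathfinish g = ?F pi"
    "pathstart A = ?F pi" "pathfinish A = ?F pi"
    "pathstart B1 = ?F pi" "pathfinish B1 = ?F (3 * pi / 2)"
    "pathstart B2 = ?F (3 * pi / 2)" "pathfinish B2 = ?F (2 * pi)"
    "pathstart C1 = ?F (2 * pi)" "pathfinish C1 = ?F (5 * pi / 2)"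
    "pathstart C2 = ?F (5 * pi / 2)" "pathfinish C2 = ?F pi"
    "pathstart D = ?F (3 * pi / 2)" "pathfinish D = ?F (5 * pi / 2)"
    "pathstart K = ?F pi" "pathfinish K = ?F pi"
    using torus_base(1) torus_periodic(2) [of pi 0] F3
    by (simp_all add: g_def A_def B1_def B2_def C1_def C2_def D_def K_def pathstart_compose pathfinish_compose
        torus_line_path circ_simps fibre_base [unfolded of_real_diff of_real_1])
  have q_ends: "pathstart q = ?F pi" "pathfinish q = ?F (2 * pi)"
  proof -
    have "torus (2 * pi, - 2 * pi) = torus (2 * pi, 0)"
      using torus_periodic(2) [of "2 * pi" "- 2 * pi"] by simp
    also have "\<dots> = ?F (2 * pi)"
      by (simp add: torus_def fibre_def)
    finally show "pathfinish q = ?F (2 * pi)"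
      unfolding q_def torus_line_path .
    show "pathstart q = ?F pi"
      unfolding q_def torus_line_path torus_base circ_simps ..
  qed
  note arc = fibre_path [OF path_arc_path arc_path_dom]
  have at0: "?at (rho m \<epsilon>)" "?at (rho_last m \<epsilon> r)"
    using rho_loop rho_last_loop_m [OF sr] by (simp_all add: path_at_loops)
  have g: "?at g"
    by (rule path_at_next [OF at0(1)])
       (use fibre_path [OF approach_ends(1) approach_dom] ends rho_ends in \<open>simp_all add: g_def\<close>)
  have A: "?at A" and K: "?at K" and B1: "?at B1" and q: "?at q"
    by (rule path_at_next [OF g]; use arc torus_line_path ends q_ends in \<open>simp add: A_def K_def B1_def q_def\<close>)+
  have D: "?at D"
    by (rule path_at_next [OF B1])
       (use fibre_path [OF diameter_ends(1) diameter_dom] ends in \<open>simp_all add: D_def\<close>)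
  have B2: "?at B2"
    by (rule path_at_next [OF B1]) (use arc ends in \<open>simp_all add: B2_def\<close>)
  have C1: "?at C1"
    by (rule path_at_next [OF B2]) (use arc ends in \<open>simp_all add: C1_def\<close>)
  have C2: "?at C2"
    by (rule path_at_next [OF C1]) (use arc ends in \<open>simp_all add: C2_def\<close>)
  note at = at0 g A K B1 q D B2 C1 C2
  note rules = at path_at_join path_at_reverse holonomy_join holonomy_reverse ends q_ends rho_ends
  have car: "?hol p \<in> carrier G" if "?at p" for p
    unfolding G_def using that by (rule holonomy_carrier)
  note car = at [THEN car]
  note G = G_def [symmetric]
  have hh: "?hol h = ?hol B1 \<otimes>\<^bsub>G\<^esub> (?hol D \<otimes>\<^bsub>G\<^esub> ?hol C2)"
    unfolding h_eq by (simp add: rules G)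
  have hh': "?hol h' = ?hol C1 \<otimes>\<^bsub>G\<^esub> (inv\<^bsub>G\<^esub> ?hol D \<otimes>\<^bsub>G\<^esub> ?hol B2)"
    unfolding h'_eq by (simp add: rules G)
  have h_at: "?at h" "?at h'" "pathstart h = ?F pi" "pathfinish h = ?F pi" "pathstart h' = ?F (2 * pi)" "pathfinish h' = ?F (2 * pi)"
    unfolding h_eq h'_eq by (simp_all add: rules)
  have hq: "?hol q = inv\<^bsub>G\<^esub> ?hol A \<otimes>\<^bsub>G\<^esub> (inv\<^bsub>G\<^esub> ?hol C2 \<otimes>\<^bsub>G\<^esub> inv\<^bsub>G\<^esub> ?hol C1)"
    using holonomy_homotopic [OF rotation_path [folded A_def C1_def C2_def q_def] q] by (simp add: rules G)
  have "?hol (h +++ q) = ?hol (q +++ h')"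
    by (rule holonomy_homotopic [OF half_loop_rotation [folded h_def h'_def q_def]]) (simp add: rules h_at)
  then have bq: "?hol h \<otimes>\<^bsub>G\<^esub> ?hol q = ?hol q \<otimes>\<^bsub>G\<^esub> ?hol h'"
    by (simp add: rules h_at G)
  have hK: "?hol K = ?hol B1 \<otimes>\<^bsub>G\<^esub> (?hol B2 \<otimes>\<^bsub>G\<^esub> (?hol C1 \<otimes>\<^bsub>G\<^esub> ?hol C2))"
    using holonomy_homotopic [OF circle_split [folded K_def B1_def B2_def C1_def C2_def] K] by (simp add: rules G)
  have word: "?hol h \<otimes>\<^bsub>G\<^esub> (?hol A \<otimes>\<^bsub>G\<^esub> (?hol h \<otimes>\<^bsub>G\<^esub> inv\<^bsub>G\<^esub> ?hol A)) = ?hol K"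
    unfolding hK by (rule half_twist_word [OF _ _ _ _ _ _ hh hh' hq bq]) (rule car)+
  have "?hol (A +++ K) = ?hol (K +++ A)"
    by (rule holonomy_homotopic [OF circle_meridian_commute [folded A_def K_def]]) (simp add: rules)
  then have AK: "?hol A \<otimes>\<^bsub>G\<^esub> ?hol K = ?hol K \<otimes>\<^bsub>G\<^esub> ?hol A"
    by (simp add: rules G)
  have "?hol (rho m \<epsilon> +++ g) = ?hol (g +++ A)"
    by (rule holonomy_homotopic [OF rho_approach [folded g_def A_def]]) (simp add: rules)
  then have ag: "?hol (rho m \<epsilon>) \<otimes>\<^bsub>G\<^esub> ?hol g = ?hol g \<otimes>\<^bsub>G\<^esub> ?hol A"
    by (simp add: rules G)
  have "?hol (rho m \<epsilon>) = (?hol (rho m \<epsilon>) \<otimes>\<^bsub>G\<^esub> ?hol g) \<otimes>\<^bsub>G\<^esub> inv\<^bsub>G\<^esub> ?hol g"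
    using car by (simp add: m_assoc)
  then have ra: "a = ?hol g \<otimes>\<^bsub>G\<^esub> (?hol A \<otimes>\<^bsub>G\<^esub> inv\<^bsub>G\<^esub> ?hol g)"
    unfolding ag a_def using car holonomy_loops_at [OF rho_loop] by (simp add: m_assoc)
  have rb: "b = ?hol g \<otimes>\<^bsub>G\<^esub> (?hol h \<otimes>\<^bsub>G\<^esub> inv\<^bsub>G\<^esub> ?hol g)"
    using holonomy_homotopic [OF rho_last_half_loop [OF sr, folded g_def h_def] at0(2)] holonomy_loops_at [OF rho_last_loop_m [OF sr]]
    unfolding b_def by (simp add: rules h_at G)
  have rc: "c = ?hol g \<otimes>\<^bsub>G\<^esub> (?hol K \<otimes>\<^bsub>G\<^esub> inv\<^bsub>G\<^esub> ?hol g)"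
    using holonomy_loops_at [OF big_loop_loop] unfolding c_def big by (simp add: rules G)
  have ch: "?hol h \<in> carrier G"
    using car by (simp add: hh)
  note simps = m_assoc inv_cancel inv_mult_group
  have "b \<otimes>\<^bsub>G\<^esub> (a \<otimes>\<^bsub>G\<^esub> (b \<otimes>\<^bsub>G\<^esub> inv\<^bsub>G\<^esub> a)) =
      ?hol g \<otimes>\<^bsub>G\<^esub> ((?hol h \<otimes>\<^bsub>G\<^esub> (?hol A \<otimes>\<^bsub>G\<^esub> (?hol h \<otimes>\<^bsub>G\<^esub> inv\<^bsub>G\<^esub> ?hol A))) \<otimes>\<^bsub>G\<^esub> inv\<^bsub>G\<^esub> ?hol g)"
    unfolding ra rb using car ch by (simp add: simps)
  then show "b \<otimes>\<^bsub>G\<^esub> (a \<otimes>\<^bsub>G\<^esub> (b \<otimes>\<^bsub>G\<^esub> inv\<^bsub>G\<^esub> a)) = c"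
    unfolding word rc .
  have "c \<otimes>\<^bsub>G\<^esub> a = ?hol g \<otimes>\<^bsub>G\<^esub> ((?hol K \<otimes>\<^bsub>G\<^esub> ?hol A) \<otimes>\<^bsub>G\<^esub> inv\<^bsub>G\<^esub> ?hol g)"
    unfolding ra rc using car by (simp add: simps)
  also have "\<dots> = a \<otimes>\<^bsub>G\<^esub> c"
    unfolding ra rc AK [symmetric] using car by (simp add: simps)
  finally show "c \<otimes>\<^bsub>G\<^esub> a = a \<otimes>\<^bsub>G\<^esub> c" .
qed

text \<open>The first group relation, read back as a homotopy of paths, survives the inclusion into
  \<open>Xtilde m\<close>.\<close>

lemma generator_word_homotopic:
  assumes sr: "small_radius m \<epsilon> r"
  shows "homotopic_paths (Xspace m)
    (rho_last m \<epsilon> r +++ rho m \<epsilon> +++ rho_last m \<epsilon> r +++ reversepath (rho m \<epsilon>)) big_loop"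
proof -
  note l = rho_loop rho_last_loop_m [OF sr] loops_at_reverse [OF rho_loop]
  let ?w = "rho_last m \<epsilon> r +++ rho m \<epsilon> +++ rho_last m \<epsilon> r +++ reversepath (rho m \<epsilon>)"
  have w: "?w \<in> loops_at (Xspace m) (basept m \<epsilon>)"
    using l by (intro loops_at_join)
  have "path_class (Xspace m) ?w = path_class (Xspace m) big_loop"
    using fundamental_relations(1) [OF sr] l
    by (simp add: path_class_mult [symmetric] path_class_inv [symmetric] loops_at_join)
  moreover have "path ?w" "path_image ?w \<subseteq> Xspace m"
    using w unfolding loops_at_def by blast+
  ultimately show ?thesis
    using path_class_eq_iff by blast
qed

section \<open>Filling in the last coordinate hyperplane\<close>

lemma base_segment_path:
  "path (base_segment m \<epsilon>)" "path_image (base_segment m \<epsilon>) \<subseteq> Xtilde m"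
  "pathstart (base_segment m \<epsilon>) = basept m \<epsilon>" "pathfinish (base_segment m \<epsilon>) = chart (of_real (s - 1)) 0"
proof -
  have h: "base_segment m \<epsilon> = (\<lambda>t. chart (of_real (s - 1)) (of_real ((1 - t) * e\<^sup>2)))"
    by (rule ext) (rule base_segment_chart)
  show "path (base_segment m \<epsilon>)"
    unfolding h path_def by (intro continuous_on_chart continuous_intros)
  have "chart (of_real (s - 1)) (of_real ((1 - t) * e\<^sup>2)) \<in> Xtilde m" if "t \<in> {0..1}" for t
  proof -
    have "(1 - t) * e\<^sup>2 \<le> 1 * e\<^sup>2"
      using that by (intro mult_right_mono) auto
    then have n: "cmod (of_real ((1 - t) * e\<^sup>2)) \<le> e\<^sup>2"
      using that by (simp only: norm_of_real) (simp add: abs_mult)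
    have "2 * e \<le> cmod (of_real (s - 1))"
      using s_2e by (simp del: of_real_diff)
    then show ?thesis
      using s_pos s_half e_pos by (intro chart_Xtilde n outer) auto
  qed
  then show "path_image (base_segment m \<epsilon>) \<subseteq> Xtilde m"
    by (auto simp: h path_image_def)
  show "pathstart (base_segment m \<epsilon>) = basept m \<epsilon>" "pathfinish (base_segment m \<epsilon>) = chart (of_real (s - 1)) 0"
    using chart_basept by (simp_all add: pathstart_def pathfinish_def h)
qed

text \<open>As \<open>z\<close> shrinks from \<open>e^2\<close> to \<open>0\<close>, the parabola
  stays inside \<open>cmod y \<le> e\<close>, hence away from the lasso of radius
  \<open>2 e\<close>. The base point traces \<open>base_segment\<close>, which yields the
  conjugation.\<close>

lemma big_loop_pushed:
  "homotopic_paths (Xtilde m) big_loop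
    (base_segment m \<epsilon> +++ ((\<lambda>y. chart y 0) \<circ> real_lasso (s - 1) 0 (2 * e)) +++ reversepath (base_segment m \<epsilon>))"
proof -
  let ?L = "real_lasso (s - 1) 0 (2 * e)"
  define H where "H x = chart (?L (fst x)) (of_real ((1 - snd x) * e\<^sup>2))" for x :: "real \<times> real"
  have L: "2 * e \<le> cmod (?L t)" "-1 < Re (?L t)" "Re (?L t) \<le> 2 * e" if "t \<in> {0..1}" for t
  proof -
    have "?L t \<in> path_image ?L"
      using that by (auto simp: path_image_def)
    then show "2 * e \<le> cmod (?L t)" "-1 < Re (?L t)" "Re (?L t) \<le> 2 * e"
      using real_lasso_image_subset [of "2 * e" "s - 1" 0] real_lasso_box [of "2 * e" "s - 1" 0 "?L t"] s_2e e_pos s_pos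
      by auto
  qed
  have cL: "continuous_on ({0..1} \<times> {0..1}) (\<lambda>x::real\<times>real. ?L (fst x))"
    using real_lasso_path(1) [of "s - 1" 0 "2 * e"] unfolding path_def
    by (rule continuous_on_compose2) (auto intro!: continuous_intros)
  have cH: "continuous_on ({0..1} \<times> {0..1}) H"
    unfolding H_def by (intro continuous_on_chart cL continuous_intros)
  have H: "H x \<in> Xtilde m" if "x \<in> {0..1} \<times> {0..1}" for x
  proof -
    have t: "fst x \<in> {0..1}" "snd x \<in> {0..1}"
      using that by auto
    then have "(1 - snd x) * e\<^sup>2 \<le> 1 * e\<^sup>2"
      by (intro mult_right_mono) auto
    then have "cmod (of_real ((1 - snd x) * e\<^sup>2)) \<le> e\<^sup>2"
      using t(2) by (simp only: norm_of_real) (simp add: abs_mult)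
    then show ?thesis
      unfolding H_def using L [OF t(1)] by (intro chart_Xtilde outer) auto
  qed
  have ends: "?L 0 = of_real (s - 1)" "?L 1 = of_real (s - 1)"
    using real_lasso_path(2,3) [of "s - 1" 0 "2 * e"] unfolding pathstart_def pathfinish_def .
  have "homotopic_paths (Xtilde m) ((\<lambda>x. H (x, 0)) +++ (\<lambda>t. H (1, t))) ((\<lambda>t. H (0, t)) +++ (\<lambda>x. H (x, 1)))"
    using cH H by (intro homotopic_paths_square) auto
  moreover have "(\<lambda>x. H (x, 0)) = big_loop" "(\<lambda>x. H (x, 1)) = (\<lambda>y. chart y 0) \<circ> ?L"
    by (simp_all add: H_def big_loop_def fibre_def fun_eq_iff)
  moreover have "(\<lambda>t. H (1, t)) = base_segment m \<epsilon>" "(\<lambda>t. H (0, t)) = base_segment m \<epsilon>"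
    by (simp_all only: H_def fst_conv snd_conv ends fun_eq_iff base_segment_chart simp_thms)
  ultimately have sq: "homotopic_paths (Xtilde m) (big_loop +++ base_segment m \<epsilon>) (base_segment m \<epsilon> +++ ((\<lambda>y. chart y 0) \<circ> ?L))"
    by simp
  have c0: "(\<lambda>y. chart y 0) \<circ> ?L = (\<lambda>x. H (x, 1))"
    by (simp add: H_def fun_eq_iff)
  have "path (\<lambda>x. H (x, 1))"
    unfolding path_def by (rule continuous_on_compose2 [OF cH]) (auto intro!: continuous_intros)
  then have "(\<lambda>y. chart y 0) \<circ> ?L \<in> loops_at (Xtilde m) (chart (of_real (s - 1)) 0)"
    using H unfolding c0 by (simp add: loops_at_def path_image_def image_subset_iff pathstart_def pathfinish_def) (simp add: H_def ends)
  moreover have "big_loop \<in> loops_at (Xtilde m) (basept m \<epsilon>)"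
    using big_loop_loop Xspace_subset_Xtilde unfolding loops_at_def by blast
  ultimately show ?thesis
    using base_segment_path sq by (intro homotopic_paths_conjugate)
qed

text \<open>At \<open>z = 0\<close> the coordinate \<open>y\<close> is the coordinate
  \<open>p\<close> of \<open>rho_last_homotopic\<close> for \<open>m - 1\<close> variables.\<close>

lemma chart_append_zero: "append_zero m (line_point (m - 1) \<epsilon> (((1 + p) / of_real s)\<^sup>2)) = chart p 0"
  using m by (auto simp: append_zero_def line_point_def chart_def pt_def basept_def fun_eq_iff)

lemma append_zero_rho_last:
  assumes sr: "small_radius (m - 1) \<epsilon> r"
  shows "homotopic_paths (Xtilde m) (append_zero m \<circ> rho_last (m - 1) \<epsilon> r)
    ((\<lambda>y. chart y 0) \<circ> real_lasso (s - 1) 0 (2 * e))"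
proof -
  have r: "0 < r"
    using sr by (simp add: small_radius_def)
  \<comment> \<open>\<open>\<rho> \<le> e\<close> implies the required
    \<open>\<rho> \<le> s / 2\<close>, because \<open>2 e < s\<close>.\<close>
  define \<rho> where "\<rho> = min e (r * s\<^sup>2 / 3)"
  have \<rho>: "0 < \<rho>" "\<rho> \<le> e" "\<rho> \<le> s / 2" "\<rho> \<le> r * s\<^sup>2 / 3"
    using r s_pos e_pos two_e_s by (auto simp: \<rho>_def)
  let ?L = "real_lasso (s - 1) 0"
  have "continuous_on A (append_zero m)" for A
  proof (rule continuous_on_coordinatewise_then_product)
    show "continuous_on A (\<lambda>x. append_zero m x i)" for i
      using continuous_on_subset [OF continuous_on_product_coordinates [of i], of A] by (cases "i = m") (simp_all add: append_zero_def)
  qed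
  moreover have "homotopic_paths (Xspace (m - 1)) (rho_last (m - 1) \<epsilon> r)
      ((\<lambda>p. line_point (m - 1) \<epsilon> (((1 + p) / of_real s)\<^sup>2)) \<circ> ?L \<rho>)"
    by (rule rho_last_homotopic [of "m - 1" \<epsilon> r \<rho>, folded s_def]) (use m pos s_half sr \<rho> in auto)
  ultimately have "homotopic_paths (Xtilde m) (append_zero m \<circ> rho_last (m - 1) \<epsilon> r)
      (append_zero m \<circ> ((\<lambda>p. line_point (m - 1) \<epsilon> (((1 + p) / of_real s)\<^sup>2)) \<circ> ?L \<rho>))"
    using append_zero_Xspace [OF m] by (intro homotopic_paths_continuous_image) auto
  moreover have "append_zero m \<circ> ((\<lambda>p. line_point (m - 1) \<epsilon> (((1 + p) / of_real s)\<^sup>2)) \<circ> ?L \<rho>) = (\<lambda>y. chart y 0) \<circ> ?L \<rho>"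
    by (simp only: comp_def chart_append_zero)
  moreover have "homotopic_paths (Xtilde m) ((\<lambda>y. chart y 0) \<circ> ?L \<rho>) ((\<lambda>y. chart y 0) \<circ> ?L (2 * e))"
  proof -
    \<comment> \<open>At \<open>z = 0\<close> the two points of the parabola have merged into the
      single puncture \<open>y = 0\<close>, so the lasso may be widened to radius
      \<open>2 e\<close>.\<close>
    define A where "A = strip (s - 1) (2 * e) (2 * e)"
    have "?L \<rho>' p \<in> A - {of_real 0}" if "0 < \<rho>'" "\<rho>' \<le> 2 * e" "p \<in> {0..1}" for \<rho>' p
      using real_lasso_box [of \<rho>' "s - 1" 0 "?L \<rho>' p"] that s_2e by (auto simp: path_image_def A_def mem_strip)
    then have im: "path_image (?L \<rho>') \<subseteq> A - {of_real 0}" if "0 < \<rho>'" "\<rho>' \<le> 2 * e" for \<rho>'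
      using that by (auto simp: path_image_def)
    have "homotopic_paths (A - {of_real 0}) (?L \<rho>) (?L (2 * e))"
    proof (rule homotopic_paths_punctured_convex)
      show "convex A" "closed A"
        by (simp_all add: A_def strip_convex strip_closed)
      show "of_real 0 \<in> interior A"
        using e_pos s_half by (simp add: A_def strip_interior)
      show "path_image (?L \<rho>) \<subseteq> A - {of_real 0}" "path_image (?L (2 * e)) \<subseteq> A - {of_real 0}"
        by (rule im; use \<rho> e_pos in simp)+
      show "winding_number (?L \<rho>) (of_real 0) = winding_number (?L (2 * e)) (of_real 0)"
        using winding_number_real_lasso [of \<rho> "s - 1" 0] winding_number_real_lasso [of "2 * e" "s - 1" 0] \<rho> e_pos s_2e
        by simp
    qed simp_all
    then show ?thesis
    proof (rule homotopic_paths_continuous_image)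
      show "continuous_on (A - {of_real 0}) (\<lambda>y. chart y 0)"
        by (intro continuous_on_chart continuous_intros)
      show "(\<lambda>y. chart y 0) \<in> A - {of_real 0} \<rightarrow> Xtilde m"
      proof
        fix y assume "y \<in> A - {of_real 0}"
        then have "-1 < Re y" "Re y \<le> 2 * e" "y\<^sup>2 \<noteq> 0"
          using s_pos by (auto simp: A_def mem_strip)
        then show "chart y 0 \<in> Xtilde m"
          by (intro chart_Xtilde) auto
      qed
    qed
  qed
  ultimately show ?thesis
    by (simp only:) (rule homotopic_paths_trans)
qed

lemma generator_word_Xtilde:
  assumes "small_radius m \<epsilon> r" "small_radius (m - 1) \<epsilon> r'"
  shows "homotopic_paths (Xtilde m)
        (rho_last m \<epsilon> r +++ rho m \<epsilon> +++ rho_last m \<epsilon> r +++ reversepath (rho m \<epsilon>))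
        (base_segment m \<epsilon> +++ (append_zero m \<circ> rho_last (m - 1) \<epsilon> r') +++ reversepath (base_segment m \<epsilon>))"
proof -
  let ?c = "(\<lambda>y. chart y 0) \<circ> real_lasso (s - 1) 0 (2 * e)"
  have c: "homotopic_paths (Xtilde m) ?c (append_zero m \<circ> rho_last (m - 1) \<epsilon> r')"
    by (rule homotopic_paths_sym [OF append_zero_rho_last [OF assms(2)]])
  have "homotopic_paths (Xtilde m)
        (rho_last m \<epsilon> r +++ rho m \<epsilon> +++ rho_last m \<epsilon> r +++ reversepath (rho m \<epsilon>)) big_loop"
    by (rule homotopic_paths_subset [OF generator_word_homotopic [OF assms(1)] Xspace_subset_Xtilde])
  also note big_loop_pushed
  also have "homotopic_paths (Xtilde m) (base_segment m \<epsilon> +++ ?c +++ reversepath (base_segment m \<epsilon>))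
       (base_segment m \<epsilon> +++ (append_zero m \<circ> rho_last (m - 1) \<epsilon> r') +++ reversepath (base_segment m \<epsilon>))"
    using c base_segment_path by (intro homotopic_paths_join) (auto simp: pathstart_compose pathfinish_compose)
  finally show ?thesis .
qed

end

section \<open>The choice of the base point\<close>

text \<open>The bound \<open>1 / (4 m^2)\<close> makes every square root less than
  \<open>1 / (2 m)\<close>, hence their sum less than \<open>1/2\<close>; the quarter of the minimum
  gives the factor 4 between the last entry and the earlier ones. The case distinction keeps the
  value positive on arbitrary lists.\<close>

definition smallness :: "nat \<Rightarrow> real list \<Rightarrow> real"
  where "smallness m es = (let d = 1 / (4 * (real m)\<^sup>2) in
     if es \<noteq> [] \<and> 0 < Min (set es) then min d (Min (set es) / 4) else d)"

lemma smallness_pos: "0 < m \<Longrightarrow> 0 < smallness m es"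
  by (simp add: smallness_def Let_def)

lemma successively_small_base:
  assumes m: "m \<ge> 2" and ss: "successively_small (smallness m) m \<epsilon>"
  shows "small_base m \<epsilon>"
proof
  have e: "0 < \<epsilon> j" "\<epsilon> j < smallness m (map \<epsilon> [1..<j])" if "j \<in> {1..m}" for j
    using ss that by (auto simp: successively_small_def)
  show "2 \<le> m" "\<forall>j\<in>{1..m}. 0 < \<epsilon> j"
    using m e by auto
  have "sqrt (\<epsilon> j) < 1 / (2 * real m)" if "j \<in> {1..m}" for j
  proof -
    have "\<epsilon> j < 1 / (4 * (real m)\<^sup>2)"
      using e(2) [OF that] by (auto simp: smallness_def Let_def split: if_splits)
    also have "\<dots> = (1 / (2 * real m))\<^sup>2"
      by (simp add: power_divide power_mult_distrib)
    finally show ?thesis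
      using real_sqrt_less_mono by fastforce
  qed
  then have "(\<Sum>j\<in>{1..m}. sqrt (\<epsilon> j)) < (\<Sum>j\<in>{1..m}. 1 / (2 * real m))"
    using m by (intro sum_strict_mono) auto
  also have "\<dots> = 1 / 2"
    using m by simp
  finally show "(\<Sum>j\<in>{1..m}. sqrt (\<epsilon> j)) < 1 / 2" .
  show "\<forall>j\<in>{1..m-1}. 4 * \<epsilon> m < \<epsilon> j"
  proof
    fix j assume j: "j \<in> {1..m-1}"
    let ?es = "map \<epsilon> [1..<m]"
    have es: "set ?es = \<epsilon> ` {1..<m}" "?es \<noteq> []"
      using m by auto
    have "Min (set ?es) \<in> set ?es"
      using es(2) by (intro Min_in) auto
    then have "0 < Min (set ?es)"
      unfolding es(1) using e(1) by auto
    then have "\<epsilon> m < Min (set ?es) / 4"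
      using e(2) [of m] m es(2) by (auto simp: smallness_def Let_def simp del: set_map)
    moreover have "Min (set ?es) \<le> \<epsilon> j"
      using j m by (intro Min_le) auto
    ultimately show "4 * \<epsilon> m < \<epsilon> j"
      by linarith
  qed
qed

theorem lemma4p1:
  fixes m :: nat
  assumes "m \<ge> 2"
  shows "\<exists>\<delta> :: real list \<Rightarrow> real. (\<forall>es. 0 < \<delta> es) \<and>
    (\<forall>(\<epsilon> :: nat \<Rightarrow> real) (r :: real) (r' :: real).
      successively_small \<delta> m \<epsilon> \<longrightarrow> small_radius m \<epsilon> r \<longrightarrow> small_radius (m - 1) \<epsilon> r' \<longrightarrow>
      (let G = fundamental_group (Xspace m) (basept m \<epsilon>);
           a = path_class (Xspace m) (rho m \<epsilon>);
           b = path_class (Xspace m) (rho_last m \<epsilon> r)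
       in a \<in> carrier G \<and> b \<in> carrier G \<and>
          (b \<otimes>\<^bsub>G\<^esub> a \<otimes>\<^bsub>G\<^esub> b \<otimes>\<^bsub>G\<^esub> inv\<^bsub>G\<^esub> a) \<otimes>\<^bsub>G\<^esub> a = a \<otimes>\<^bsub>G\<^esub> (b \<otimes>\<^bsub>G\<^esub> a \<otimes>\<^bsub>G\<^esub> b \<otimes>\<^bsub>G\<^esub> inv\<^bsub>G\<^esub> a)) \<and>
      append_zero m ` Xspace (m - 1) \<subseteq> Xtilde m \<and>
      rho_last (m - 1) \<epsilon> r' \<in> loops_at (Xspace (m - 1)) (basept (m - 1) \<epsilon>) \<and>
      homotopic_paths (Xtilde m)
        (rho_last m \<epsilon> r +++ rho m \<epsilon> +++ rho_last m \<epsilon> r +++ reversepath (rho m \<epsilon>))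
        (base_segment m \<epsilon> +++ (append_zero m \<circ> rho_last (m - 1) \<epsilon> r') +++ reversepath (base_segment m \<epsilon>)))"
proof (intro exI [of _ "smallness m"] conjI allI impI)
  show "0 < smallness m es" for es
    using assms by (intro smallness_pos) simp
  fix \<epsilon> :: "nat \<Rightarrow> real" and r r' :: real
  assume "successively_small (smallness m) m \<epsilon>" and r: "small_radius m \<epsilon> r" and r': "small_radius (m - 1) \<epsilon> r'"
  interpret small_base m \<epsilon>
    by (rule successively_small_base) fact+
  note l = rho_loop rho_last_loop_m [OF r]
  let ?G = "fundamental_group (Xspace m) (basept m \<epsilon>)"
  let ?a = "path_class (Xspace m) (rho m \<epsilon>)" and ?b = "path_class (Xspace m) (rho_last m \<epsilon> r)"
  have car: "?a \<in> carrier ?G" "?b \<in> carrier ?G"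
    using l by (auto simp: fundamental_group_def)
  have "basept m \<epsilon> \<in> Xspace m"
    using rho_loop pathstart_in_path_image [of "rho m \<epsilon>"] by (auto simp: loops_at_def)
  then interpret group ?G
    by (rule fundamental_group_group)
  have "?b \<otimes>\<^bsub>?G\<^esub> ?a \<otimes>\<^bsub>?G\<^esub> ?b \<otimes>\<^bsub>?G\<^esub> inv\<^bsub>?G\<^esub> ?a = path_class (Xspace m) big_loop"
    using fundamental_relations(1) [OF r] car by (simp add: m_assoc)
  then show "let G = ?G; a = ?a; b = ?b
       in a \<in> carrier G \<and> b \<in> carrier G \<and>
          (b \<otimes>\<^bsub>G\<^esub> a \<otimes>\<^bsub>G\<^esub> b \<otimes>\<^bsub>G\<^esub> inv\<^bsub>G\<^esub> a) \<otimes>\<^bsub>G\<^esub> a = a \<otimes>\<^bsub>G\<^esub> (b \<otimes>\<^bsub>G\<^esub> a \<otimes>\<^bsub>G\<^esub> b \<otimes>\<^bsub>G\<^esub> inv\<^bsub>G\<^esub> a)"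
    unfolding Let_def using fundamental_relations(2) [OF r] car by simp
  show "append_zero m ` Xspace (m - 1) \<subseteq> Xtilde m"
    using append_zero_Xspace [OF assms] by blast
  show "rho_last (m - 1) \<epsilon> r' \<in> loops_at (Xspace (m - 1)) (basept (m - 1) \<epsilon>)"
    using m pos s_half r' by (intro rho_last_loop) (auto simp: s_def)
  show "homotopic_paths (Xtilde m)
        (rho_last m \<epsilon> r +++ rho m \<epsilon> +++ rho_last m \<epsilon> r +++ reversepath (rho m \<epsilon>))
        (base_segment m \<epsilon> +++ (append_zero m \<circ> rho_last (m - 1) \<epsilon> r') +++ reversepath (base_segment m \<epsilon>))"
    by (rule generator_word_Xtilde [OF r r'])
qed

end
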